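(* Let $(\mathbf{x}^k)_{k\ge 1}$ be the sequence generated by Adam (as defined in the context). Assume: (i) $\mathbb{E}[\mathbf{g}^k\mid\mathcal{F}^k]=\nabla f(\mathbf{x}^k)$ for all $k\ge1$, and there exists $M>0$ such that $\|\mathbf{g}^k\|\le M$ almost surely for all $k\ge1$; (ii) $f$ is bounded below, with $f^*:=\inf_{\mathbf{x}\in\mathbb{R}^d} f(\mathbf{x})>-\infty$, and $f$ is $L$-smooth for some $L>0$, i.e. $\|\nabla f(\mathbf{x})-\nabla f(\mathbf{y})\|\le L\|\mathbf{x}-\mathbf{y}\|$ for all $\mathbf{x},\mathbf{y}\in\mathbb{R}^d$; (iii) $\sum_{k=1}^{\infty}\eta_k=\infty$, $\sum_{k=1}^{\infty}\eta_k^2<\infty$, $\sum_{k=1}^{\infty}\eta_k(1-\theta_k)<\infty$; (iv) there exist a non-increasing real sequence $(\alpha_k)_{k\ge1}$ and positive constants $C_0,\tilde C_0$ such that $C_0\alpha_k\le\eta_k\le\tilde C_0\alpha_k$ for all $k\ge1$. Then $$\lim_{k\to\infty}\|\nabla f(\mathbf{x}^k)\|=0\ \text{ almost surely, and}\quad \lim_{k\to\infty}\mathbb{E}\big[\|\nabla f(\mathbf{x}^k)\|\big]=0.$$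
   Context: Setting: $f:\mathbb{R}^d\to\mathbb{R}$ is differentiable, $f(\mathbf{x})=\mathbb{E}_{\xi\sim\mathbb{P}}[\ell(\mathbf{x};\xi)]$. All vector operations (powers, square roots, products, quotients, adding a scalar) are element-wise; $\|\cdot\|$ is the Euclidean norm. Adam: given deterministic parameters $\eta_k>0$ (step size), $\epsilon>0$, $0\le\beta_k\le\beta<1$, $\theta_k\in(0,1)$ for $k\ge1$, initialize $\mathbf{m}^0=\mathbf{0}$, $\mathbf{v}^0=\mathbf{0}$, $\mathbf{x}^1\in\mathbb{R}^d$ (deterministic). For $k=1,2,\dots$: sample the stochastic gradient $\mathbf{g}^k=\nabla\ell(\mathbf{x}^k;\xi^k)$, where $\xi^k$ is the random data sample drawn at iteration $k$, and set $$\mathbf{m}^k=\beta_k\mathbf{m}^{k-1}+(1-\beta_k)\mathbf{g}^k,\quad \mathbf{v}^k=\theta_k\mathbf{v}^{k-1}+(1-\theta_k)(\mathbf{g}^k)^2,\quad \mathbf{x}^{k+1}=\mathbf{x}^k-\eta_k\frac{\mathbf{m}^k}{\sqrt{\mathbf{v}^k+\epsilon}}.$$ $\mathcal{F}^k:=\sigma(\mathbf{x}^1,\dots,\mathbf{x}^k)$. *)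

theory Defs
  imports "HOL-Probability.Probability"
begin

text \<open>
  One trajectory of Adam driven by stochastic gradients \<open>g\<close>. Only \<open>g k\<close>, \<open>\<eta> k\<close>, \<open>\<beta> k\<close>, \<open>\<theta> k\<close>
  and \<open>x k\<close> with \<open>k \<ge> 1\<close> are constrained; the entries at index 0 are irrelevant. The step size
  and the moment coefficients are scalars, while squares, square roots and quotients of vectors
  are taken componentwise.
\<close>

definition adam_trajectory ::
  "(nat \<Rightarrow> real) \<Rightarrow> real \<Rightarrow> (nat \<Rightarrow> real) \<Rightarrow> (nat \<Rightarrow> real) \<Rightarrow> real ^ 'd \<Rightarrow>
   (nat \<Rightarrow> real ^ 'd) \<Rightarrow> (nat \<Rightarrow> real ^ 'd) \<Rightarrow> (nat \<Rightarrow> real ^ 'd) \<Rightarrow> (nat \<Rightarrow> real ^ 'd) \<Rightarrow> bool"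
  where "adam_trajectory \<eta> \<epsilon> \<beta> \<theta> x1 g m v x \<longleftrightarrow>
    m 0 = 0 \<and> v 0 = 0 \<and> x 1 = x1 \<and>
    (\<forall>k\<ge>1.
      m k = \<beta> k *\<^sub>R m (k - 1) + (1 - \<beta> k) *\<^sub>R g k \<and>
      v k = \<theta> k *\<^sub>R v (k - 1) + (1 - \<theta> k) *\<^sub>R (\<chi> i. (g k $ i)\<^sup>2) \<and>
      x (k + 1) = x k - \<eta> k *\<^sub>R (\<chi> i. m k $ i / sqrt (v k $ i + \<epsilon>)))"

text \<open>The \<open>\<sigma>\<close>-algebra \<open>\<sigma>(x\<^sup>1, \<dots>, x\<^sup>k)\<close> on the underlying space of \<open>\<Omega>\<close>.\<close>

definition history_algebra ::
  "'w measure \<Rightarrow> (nat \<Rightarrow> 'w \<Rightarrow> 'a::topological_space) \<Rightarrow> nat \<Rightarrow> 'w measure"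
  where "history_algebra \<Omega> x k =
    sigma (space \<Omega>) {x j -` A \<inter> space \<Omega> | j A. j \<in> {1..k} \<and> A \<in> sets borel}"

text \<open>
  The library provides conditional expectations of real random variables only; for random
  vectors they are taken componentwise.
\<close>

definition vec_cond_exp ::
  "'w measure \<Rightarrow> 'w measure \<Rightarrow> ('w \<Rightarrow> real ^ 'd) \<Rightarrow> 'w \<Rightarrow> real ^ 'd"
  where "vec_cond_exp \<Omega> F X \<omega> = (\<chi> i. real_cond_exp \<Omega> F (\<lambda>\<omega>. X \<omega> $ i) \<omega>)"

end

theory Submission
  imports Defs
begin

text \<open>
  Write \<open>G\<close> for the gradient of \<open>f\<close> along the iterates, \<open>s\<close> for the denominator \<open>sqrt (v + \<epsilon>)\<close> and \<open>u = m / s\<close>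
  for the update direction, all componentwise. The second moment is not a function of the past
  iterates, so \<open>g\<close> cannot be averaged against \<open>1 / s\<close> directly. Replace \<open>s\<^sup>n\<close> by its conditional
  expectation \<open>S\<^sup>n\<close> given \<open>x\<^sup>1, \<dots>, x\<^sup>n\<^sup>+\<^sup>1\<close>. Since \<open>u\<^sup>n\<close> is a function of these iterates, testing the momentum
  recursion \<open>s\<^sup>n\<^sup>+\<^sup>1 u\<^sup>n\<^sup>+\<^sup>1 = \<beta> s\<^sup>n u\<^sup>n + (1 - \<beta>) g\<^sup>n\<^sup>+\<^sup>1\<close> against \<open>G / S\<close> gives
  \<open>E[G\<^sup>n u\<^sup>n\<^sup>+\<^sup>1] = \<beta> E[G\<^sup>n u\<^sup>n] + (1 - \<beta>) E[(G\<^sup>n)\<^sup>2 / S\<^sup>n] - E[(G\<^sup>n / S\<^sup>n) (S\<^sup>n\<^sup>+\<^sup>1 - S\<^sup>n) u\<^sup>n\<^sup>+\<^sup>1]\<close>.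
  By AM-GM the last term costs only a fraction of \<open>E[(G\<^sup>n)\<^sup>2]\<close> plus a multiple of
  \<open>E[(S\<^sup>n\<^sup>+\<^sup>1 - S\<^sup>n)\<^sup>2]\<close>, and since \<open>S\<close> is a martingale up to an error of order \<open>1 - \<theta>\<close>, this is at most
  \<open>E[(S\<^sup>n\<^sup>+\<^sup>1)\<^sup>2] - E[(S\<^sup>n)\<^sup>2] + O(1 - \<theta>)\<close>. Weighted with a non-increasing sequence the telescoping part is
  summable, so the descent inequality yields \<open>\<Sum> \<eta> E[G\<^sup>2] < \<infinity>\<close>. As the norm of \<open>G\<close> changes by \<open>O(\<eta>)\<close> in each
  step, it tends to 0 almost surely, and it is bounded, so its expectation tends to 0 as well.
\<close>

subsection \<open>Sequences\<close>

text \<open>The cubes of \<open>a\<close> have summable increments, hence converge.\<close>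

lemma tendsto_zero_if_weighted_squares_summable:
  fixes a h :: "nat \<Rightarrow> real"
  assumes a: "\<And>n. 0 \<le> a n" and h: "\<And>n. 0 < h n"
    and step: "\<And>n. \<bar>a (Suc n) - a n\<bar> \<le> c * h n"
    and h2: "summable (\<lambda>n. (h n)\<^sup>2)" and ha: "summable (\<lambda>n. h n * (a n)\<^sup>2)"
    and div: "\<not> summable h"
  shows "a \<longlonglongrightarrow> 0"
proof -
  have c: "0 \<le> c"
    using step[of 0] h[of 0] by (smt (verit) zero_le_mult_iff abs_ge_zero)
  have "h \<longlonglongrightarrow> 0"
    using tendsto_real_sqrt[OF summable_LIMSEQ_zero[OF h2]] by (simp add: less_imp_le[OF h])
  then have "Bseq h" by (rule convergent_imp_Bseq[OF convergentI])
  then obtain H where H: "\<And>n. h n \<le> H"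
    using h by (metis Bseq_def abs_le_D1 real_norm_def)
  \<comment> \<open>With \<open>?b\<close> bounding both values, an increment of the cube is at most
    \<open>c * h n\<close> times \<open>3 * ?b\<^sup>2\<close>. Expanding the square leaves a
    multiple of the summable weight \<open>h n * (a n)\<^sup>2\<close> and a term of order
    \<open>(h n) ^ 3\<close>, which the bound \<open>H\<close> reduces to order
    \<open>(h n)\<^sup>2\<close>.\<close>
  have diff: "norm (a (Suc n) ^ 3 - a n ^ 3) \<le> 6 * c * (h n * (a n)\<^sup>2) + 6 * c ^ 3 * H * (h n)\<^sup>2" for n
  proof -
    let ?b = "a n + c * h n"
    have b: "a (Suc n) \<le> ?b" "a n \<le> ?b" "0 \<le> ?b" using step[of n] a[of n] h[of n] c by auto
    have "a (Suc n) ^ 3 - a n ^ 3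
        = (a (Suc n) - a n) * (a (Suc n) * a (Suc n) + a (Suc n) * a n + a n * a n)"
      by (simp add: power3_eq_cube algebra_simps)
    then have "\<bar>a (Suc n) ^ 3 - a n ^ 3\<bar>
        = \<bar>a (Suc n) - a n\<bar> * (a (Suc n) * a (Suc n) + a (Suc n) * a n + a n * a n)"
      by (simp add: abs_mult a)
    also have "\<dots> \<le> (c * h n) * (?b * ?b + ?b * ?b + ?b * ?b)"
      by (intro mult_mono add_mono step b a add_nonneg_nonneg mult_nonneg_nonneg c less_imp_le[OF h])
    also have "\<dots> = c * h n * (3 * ?b\<^sup>2)" by (simp add: power2_eq_square)
    also have "\<dots> \<le> c * h n * (6 * (a n)\<^sup>2 + 6 * (c * h n)\<^sup>2)"
      using sum_squares_ge_zero[of "a n - c * h n" 0] c less_imp_le[OF h[of n]]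
      by (intro mult_left_mono) (auto simp: power2_eq_square algebra_simps)
    also have "\<dots> = 6 * c * (h n * (a n)\<^sup>2) + 6 * c ^ 3 * h n * (h n)\<^sup>2"
      by (simp add: power2_eq_square power3_eq_cube algebra_simps)
    also have "\<dots> \<le> 6 * c * (h n * (a n)\<^sup>2) + 6 * c ^ 3 * H * (h n)\<^sup>2"
      using H[of n] c by (intro add_left_mono mult_right_mono mult_left_mono) auto
    finally show ?thesis by simp
  qed
  have "summable (\<lambda>n. a (Suc n) ^ 3 - a n ^ 3)"
    by (rule summable_comparison_test'[OF summable_add[OF summable_mult[OF ha] summable_mult[OF h2]]])
       (rule diff)
  then have "convergent (\<lambda>n. \<Sum>k<n. a (Suc k) ^ 3 - a k ^ 3)"
    by (simp add: summable_iff_convergent)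
  then have "convergent (\<lambda>n. a n ^ 3 - a 0 ^ 3)"
    by (simp only: sum_lessThan_telescope[of "\<lambda>n. a n ^ 3"])
  then obtain q where "(\<lambda>n. a n ^ 3 - a 0 ^ 3) \<longlonglongrightarrow> q" by (auto simp: convergent_def)
  then have "(\<lambda>n. (a n ^ 3 - a 0 ^ 3) + a 0 ^ 3) \<longlonglongrightarrow> q + a 0 ^ 3"
    by (intro tendsto_intros)
  then have "(\<lambda>n. root 3 (a n ^ 3)) \<longlonglongrightarrow> root 3 (q + a 0 ^ 3)"
    by (intro tendsto_real_root) simp
  then obtain p where p: "a \<longlonglongrightarrow> p"
    using a by (simp add: real_root_power_cancel)
  \<comment> \<open>A positive limit would keep \<open>a\<close> above \<open>p / 2\<close>
    eventually. Then \<open>h n\<close> would be dominated by a multiple of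
    \<open>h n * (a n)\<^sup>2\<close>, making \<open>h\<close> summable.\<close>
  have "p = 0"
  proof (rule ccontr)
    assume "p \<noteq> 0"
    moreover have "p \<ge> 0" using LIMSEQ_le_const[OF p] a by blast
    ultimately have "p / 2 < p" "0 < p" by auto
    then have "eventually (\<lambda>n. p / 2 < a n) sequentially" using p order_tendstoD(1) by blast
    then have "eventually (\<lambda>n. norm (h n) \<le> (4 / p\<^sup>2) * (h n * (a n)\<^sup>2)) sequentially"
    proof eventually_elim
      case (elim n)
      have "h n * (p / 2)\<^sup>2 \<le> h n * (a n)\<^sup>2"
        using elim \<open>0 < p\<close> h[of n] by (intro mult_left_mono power_mono) auto
      then show ?case using h[of n] \<open>0 < p\<close> by (simp add: field_simps power2_eq_square)
    qed
    then have "summable h"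
      by (rule summable_comparison_test_ev) (rule summable_mult[OF ha])
    with div show False ..
  qed
  with p show ?thesis by simp
qed

text \<open>The mean value theorem on the segment from \<open>y\<close> to \<open>z\<close> yields
  one intermediate gradient, which is compared with \<open>G y\<close>. This costs the constant
  \<open>L\<close> instead of the sharp \<open>L / 2\<close>; only the quadratic order of the
  remainder matters below.\<close>

lemma smooth_upper_bound:
  fixes f :: "'a::real_inner \<Rightarrow> real" and G :: "'a \<Rightarrow> 'a"
  assumes diff: "\<And>y. GDERIV f y :> G y"
    and lip: "\<And>y z. norm (G y - G z) \<le> L * norm (y - z)"
  shows "f z \<le> f y + inner (G y) (z - y) + L * (norm (z - y))\<^sup>2"
proof -
  let ?\<gamma> = "\<lambda>t. y + t *\<^sub>R (z - y)"
  have "((\<lambda>t. f (?\<gamma> t)) has_derivative (\<lambda>h. inner (h *\<^sub>R (z - y)) (G (?\<gamma> t)))) (at t within {0..1})" for t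
  proof (rule has_derivative_compose[where g = f and f = ?\<gamma>])
    show "(?\<gamma> has_derivative (\<lambda>h. h *\<^sub>R (z - y))) (at t within {0..1})"
      by (auto intro!: derivative_eq_intros)
    show "(f has_derivative (\<lambda>h. inner h (G (?\<gamma> t)))) (at (?\<gamma> t))"
      using diff by (simp add: gderiv_def)
  qed
  then obtain t where t: "0 < t" "t < 1" "f (?\<gamma> 1) - f (?\<gamma> 0) = inner ((1 - 0) *\<^sub>R (z - y)) (G (?\<gamma> t))"
    using mvt_simple[of 0 1 "\<lambda>t. f (?\<gamma> t)" "\<lambda>t h. inner (h *\<^sub>R (z - y)) (G (?\<gamma> t))"]
    by auto
  have "0 \<le> L * norm (z - y)" using lip[of z y] norm_ge_zero order_trans by blast
  have "inner (G (?\<gamma> t) - G y) (z - y) \<le> norm (G (?\<gamma> t) - G y) * norm (z - y)"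
    by (rule norm_cauchy_schwarz)
  also have "\<dots> \<le> (L * norm (?\<gamma> t - y)) * norm (z - y)"
    by (intro mult_right_mono lip) simp
  also have "\<dots> = t * (L * (norm (z - y))\<^sup>2)" using t by (simp add: power2_eq_square)
  also have "\<dots> \<le> 1 * (L * (norm (z - y))\<^sup>2)"
  proof (rule mult_right_mono)
    show "0 \<le> L * (norm (z - y))\<^sup>2"
      using mult_nonneg_nonneg[OF \<open>0 \<le> L * norm (z - y)\<close> norm_ge_zero[of "z - y"]]
      by (simp add: power2_eq_square mult.assoc)
  qed (use t in simp)
  finally show ?thesis
    using t(3) by (simp add: inner_diff_left inner_diff_right inner_commute)
qed

text \<open>By Tonelli the random sum has finite expectation, so it is finite almost surely.\<close>

lemma AE_summable_if_summable_integral: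
  fixes X :: "nat \<Rightarrow> 'a \<Rightarrow> real"
  assumes int: "\<And>n. integrable M (X n)" and nonneg: "\<And>n \<omega>. 0 \<le> X n \<omega>"
    and sum: "summable (\<lambda>n. \<integral>\<omega>. X n \<omega> \<partial>M)"
  shows "AE \<omega> in M. summable (\<lambda>n. X n \<omega>)"
proof -
  have [measurable]: "X n \<in> borel_measurable M" for n using int by blast
  have "(\<integral>\<^sup>+\<omega>. (\<Sum>n. ennreal (X n \<omega>)) \<partial>M) = (\<Sum>n. \<integral>\<^sup>+\<omega>. ennreal (X n \<omega>) \<partial>M)"
    by (rule nn_integral_suminf) measurable
  also have "\<dots> = (\<Sum>n. ennreal (\<integral>\<omega>. X n \<omega> \<partial>M))"
    by (simp add: nn_integral_eq_integral int nonneg)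
  also have "\<dots> = ennreal (\<Sum>n. \<integral>\<omega>. X n \<omega> \<partial>M)"
    by (intro suminf_ennreal_eq summable_sums sum integral_nonneg_AE) (simp add: nonneg)
  finally have "AE \<omega> in M. (\<Sum>n. ennreal (X n \<omega>)) \<noteq> \<infinity>"
    by (intro nn_integral_PInf_AE) auto
  then show ?thesis
    by eventually_elim (auto intro!: summable_suminf_not_top nonneg)
qed

section \<open>Summation by parts and a descent recursion with memory\<close>

lemma abel_sum_bound:
  fixes \<alpha> T :: "nat \<Rightarrow> real"
  assumes dec: "decseq \<alpha>" and pos: "\<And>n. 0 \<le> \<alpha> n" and T: "\<And>n. 0 \<le> T n" "\<And>n. T n \<le> K"
  shows "(\<Sum>k<n. \<alpha> k * (T (Suc k) - T k)) \<le> \<alpha> 0 * K"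
proof -
  \<comment> \<open>Summation by parts as an induction. The slack
    \<open>\<alpha> n * (K - T (Suc n))\<close> has to be carried along: lowering its weight to
    \<open>\<alpha> (Suc n)\<close> is what pays for the next term. It is dropped only at the
    end.\<close>
  have "(\<Sum>k<Suc n. \<alpha> k * (T (Suc k) - T k)) \<le> \<alpha> 0 * K - \<alpha> n * (K - T (Suc n))" for n
  proof (induction n)
    case 0
    then show ?case using mult_nonneg_nonneg[OF pos[of 0] T(1)[of 0]] by (simp add: algebra_simps)
  next
    case (Suc n)
    have "\<alpha> (Suc n) * (K - T (Suc n)) \<le> \<alpha> n * (K - T (Suc n))"
      using dec T(2) by (intro mult_right_mono) (auto simp: decseq_Suc_iff)
    with Suc show ?case by (simp add: algebra_simps)
  qed
  moreover have "0 \<le> \<alpha> m * (K - T (Suc m))" for m using pos T by simp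
  moreover have "0 \<le> \<alpha> 0 * K" using pos[of 0] T[of 0] by (simp add: order_trans[OF T])
  ultimately show ?thesis by (cases n) (auto intro: order_trans simp del: sum.lessThan_Suc, smt (verit))
qed

text \<open>Deterministic core of the convergence proof. In the application \<open>h\<close> is the
  step size, \<open>F\<close> the expected objective, \<open>E\<close> the expected squared
  gradient, \<open>P\<close> and \<open>R\<close> the correlations of the gradient with the new and
  the previous update, \<open>e\<close> the expected squared change of the conditional denominators
  and \<open>T\<close> their second moment. Momentum feeds past losses back through
  \<open>R\<close>, but with a factor at most \<open>b < 1\<close>, so they stay summable against
  \<open>h\<close>.\<close>

lemma summable_if_descent_with_memory:
  fixes h \<alpha> \<beta> \<delta> F P R E e T :: "nat \<Rightarrow> real"
  assumes C: "0 < C0" "0 < C1" and dec: "decseq \<alpha>"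
    and cmp: "\<And>n. C0 * \<alpha> n \<le> h n" "\<And>n. h n \<le> C1 * \<alpha> n" and h: "\<And>n. 0 < h n"
    and h2: "summable (\<lambda>n. (h n)\<^sup>2)" and \<delta>: "\<And>n. 0 \<le> \<delta> n" "summable (\<lambda>n. h n * \<delta> n)"
    and \<beta>: "\<And>n. 0 \<le> \<beta> n" "\<And>n. \<beta> n \<le> b" "b < 1"
    and coeffs: "0 < a" "0 \<le> c1" "0 \<le> c2" "0 \<le> c3" "0 \<le> c4"
    and nonneg: "\<And>n. 0 \<le> E n" "\<And>n. 0 \<le> e n" and T: "\<And>n. 0 \<le> T n" "\<And>n. T n \<le> K"
    and F: "\<And>n. Fmin \<le> F n" "\<And>n. F (Suc n) \<le> F n - h n * P n + c1 * (h n)\<^sup>2"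
    and P: "\<And>n. \<beta> n * R n + a * E n - c2 * e n \<le> P n"
    and R: "R 0 = 0" "\<And>n. P n - c3 * h n \<le> R (Suc n)"
    and e: "\<And>n. e n \<le> T (Suc n) - T n + c4 * \<delta> n"
  shows "summable (\<lambda>n. h n * E n)"
proof -
  have b: "0 \<le> b" using \<beta>(1,2)[of 0] by linarith
  have \<alpha>: "0 < \<alpha> n" for n using h[of n] cmp(2)[of n] C(2)
    by (meson less_le_trans zero_less_mult_pos)
  \<comment> \<open>The loss accumulated in \<open>P\<close>: momentum passes on the previous loss
    and the drift \<open>c3 * h n\<close> with factor at most \<open>b\<close>, and the new step
    adds \<open>c2 * e (Suc n)\<close>.\<close>
  define N where "N = rec_nat (c2 * e 0) (\<lambda>n N. b * (N + c3 * h n) + c2 * e (Suc n))"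
  have N0: "N 0 = c2 * e 0" and NS: "N (Suc n) = b * (N n + c3 * h n) + c2 * e (Suc n)" for n
    by (simp_all add: N_def)
  have N: "0 \<le> N n" for n
    by (induction n) (simp_all add: N0 NS b coeffs nonneg less_imp_le[OF h])
  \<comment> \<open>The energy inherited from earlier steps is nonnegative and is dropped; only the
    inherited loss has to be tracked.\<close>
  have PN: "a * E n - N n \<le> P n" for n
  proof (induction n)
    case 0
    then show ?case using P[of 0] by (simp add: N0 R)
  next
    case (Suc j)
    have "- (N j + c3 * h j) \<le> R (Suc j)"
      using R(2)[of j] Suc mult_nonneg_nonneg[OF less_imp_le[OF coeffs(1)] nonneg(1)[of j]] by linarith
    then have "\<beta> (Suc j) * - (N j + c3 * h j) \<le> \<beta> (Suc j) * R (Suc j)"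
      using \<beta> by (intro mult_left_mono) auto
    moreover have "\<beta> (Suc j) * (N j + c3 * h j) \<le> b * (N j + c3 * h j)"
      using \<beta> N[of j] coeffs h[of j] by (intro mult_right_mono) auto
    ultimately show ?case using P[of "Suc j"] unfolding NS mult_minus_right by linarith
  qed
  define S2 where "S2 = (\<Sum>n. (h n)\<^sup>2)"
  define S\<delta> where "S\<delta> = (\<Sum>n. h n * \<delta> n)"
  have S2: "(\<Sum>k<n. (h k)\<^sup>2) \<le> S2" for n
    unfolding S2_def by (rule sum_le_suminf[OF h2]) auto
  have S\<delta>: "(\<Sum>k<n. h k * \<delta> k) \<le> S\<delta>" for n
    unfolding S\<delta>_def using h \<delta> by (intro sum_le_suminf) (auto intro: mult_nonneg_nonneg less_imp_le)
  have \<alpha>h: "\<alpha> k \<le> h k / C0" for k using cmp(1)[of k] C by (simp add: field_simps)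
  define Q where "Q = \<alpha> 0 * K + c4 / C0 * S\<delta>"
  \<comment> \<open>The weights are \<open>\<alpha>\<close> and not \<open>h\<close> because
    summation by parts needs monotone weights. Comparability turns the remaining part into the
    summable series of \<open>h k * \<delta> k\<close>.\<close>
  have \<alpha>e: "(\<Sum>k<n. \<alpha> k * e k) \<le> Q" for n
  proof -
    have "(\<Sum>k<n. \<alpha> k * e k) \<le> (\<Sum>k<n. \<alpha> k * (T (Suc k) - T k) + c4 / C0 * (h k * \<delta> k))"
    proof (rule sum_mono)
      fix k
      have "\<alpha> k * e k \<le> \<alpha> k * (T (Suc k) - T k) + \<alpha> k * (c4 * \<delta> k)"
        using mult_left_mono[OF e[of k] less_imp_le[OF \<alpha>]] by (simp add: algebra_simps)
      moreover have "\<alpha> k * (c4 * \<delta> k) \<le> h k / C0 * (c4 * \<delta> k)"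
        using \<alpha>h \<delta> coeffs by (intro mult_right_mono) auto
      ultimately show "\<alpha> k * e k \<le> \<alpha> k * (T (Suc k) - T k) + c4 / C0 * (h k * \<delta> k)"
        by (simp add: mult_ac)
    qed
    also have "\<dots> = (\<Sum>k<n. \<alpha> k * (T (Suc k) - T k)) + c4 / C0 * (\<Sum>k<n. h k * \<delta> k)"
      by (simp add: sum.distrib sum_distrib_left)
    also have "\<dots> \<le> Q"
      unfolding Q_def using S\<delta>[of n] coeffs C \<alpha>
      by (intro add_mono abel_sum_bound dec T mult_left_mono) (auto intro: less_imp_le)
    finally show ?thesis .
  qed
  define W where "W = (b * c3 / C0 * S2 + c2 * Q) / (1 - b)"
  \<comment> \<open>Summing the recursion for \<open>N\<close> reproduces the same weighted sum on
    the right with factor \<open>b\<close>. Moving it to the left explains the division by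
    \<open>1 - b\<close> in \<open>W\<close>.\<close>
  have \<alpha>N: "(\<Sum>k<n. \<alpha> k * N k) \<le> W" for n
  proof -
    have mono: "(\<Sum>k<n. \<alpha> k * N k) \<le> (\<Sum>k<Suc n. \<alpha> k * N k)"
      using N \<alpha> by (simp add: less_imp_le)
    have "(\<Sum>k<Suc n. \<alpha> k * N k) = \<alpha> 0 * N 0 + (\<Sum>k<n. \<alpha> (Suc k) * N (Suc k))"
      by (rule sum.lessThan_Suc_shift)
    also have "\<dots> \<le> \<alpha> 0 * (c2 * e 0) + (\<Sum>k<n. b * (\<alpha> k * N k) + b * c3 / C0 * (h k)\<^sup>2
        + c2 * (\<alpha> (Suc k) * e (Suc k)))"
      unfolding N0
    proof (intro add_left_mono sum_mono)
      fix k
      have "\<alpha> (Suc k) * (b * (N k + c3 * h k)) \<le> \<alpha> k * (b * (N k + c3 * h k))"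
        using dec b N coeffs h[of k] by (intro mult_right_mono) (auto simp: decseq_Suc_iff)
      also have "\<dots> = b * (\<alpha> k * N k) + \<alpha> k * (b * c3 * h k)" by (simp add: algebra_simps)
      also have "\<dots> \<le> b * (\<alpha> k * N k) + h k / C0 * (b * c3 * h k)"
        using \<alpha>h b coeffs h[of k] by (intro add_left_mono mult_right_mono) auto
      finally show "\<alpha> (Suc k) * N (Suc k)
        \<le> b * (\<alpha> k * N k) + b * c3 / C0 * (h k)\<^sup>2 + c2 * (\<alpha> (Suc k) * e (Suc k))"
        unfolding NS by (simp add: algebra_simps power2_eq_square)
    qed
    also have "\<dots> = b * (\<Sum>k<n. \<alpha> k * N k) + b * c3 / C0 * (\<Sum>k<n. (h k)\<^sup>2)
        + c2 * (\<Sum>k<Suc n. \<alpha> k * e k)"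
      unfolding sum.lessThan_Suc_shift
      by (simp add: sum.distrib sum_distrib_left algebra_simps)
    also have "\<dots> \<le> b * (\<Sum>k<n. \<alpha> k * N k) + b * c3 / C0 * S2 + c2 * Q"
      using S2[of n] \<alpha>e[of "Suc n"] b coeffs C by (intro add_mono mult_left_mono order_refl) auto
    finally have "(1 - b) * (\<Sum>k<n. \<alpha> k * N k) \<le> b * c3 / C0 * S2 + c2 * Q"
      using mono by (simp add: algebra_simps)
    then show ?thesis unfolding W_def using \<beta>(3) by (simp add: field_simps)
  qed
  \<comment> \<open>The descent inequalities telescope; \<open>Fmin\<close> then bounds the weighted
    energy uniformly in \<open>n\<close>.\<close>
  have bound: "F n + (\<Sum>k<n. a * (h k * E k)) \<le> F 0 + C1 * (\<Sum>k<n. \<alpha> k * N k) + c1 * (\<Sum>k<n. (h k)\<^sup>2)" for n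
  proof (induction n)
    case (Suc n)
    have "h n * (a * E n - N n) \<le> h n * P n" by (intro mult_left_mono PN less_imp_le h)
    moreover have "h n * N n \<le> C1 * \<alpha> n * N n" by (intro mult_right_mono cmp N)
    ultimately show ?case using Suc F(2)[of n] by (simp add: algebra_simps)
  qed simp
  show ?thesis
  proof (rule summableI_nonneg_bounded)
    show "0 \<le> h n * E n" for n using h[of n] nonneg by simp
    show "(\<Sum>k<n. h k * E k) \<le> (F 0 + C1 * W + c1 * S2 - Fmin) / a" for n
    proof -
      have "C1 * (\<Sum>k<n. \<alpha> k * N k) \<le> C1 * W" "c1 * (\<Sum>k<n. (h k)\<^sup>2) \<le> c1 * S2"
        using \<alpha>N[of n] S2[of n] C coeffs by (auto intro: mult_left_mono)
      then have "a * (\<Sum>k<n. h k * E k) \<le> F 0 + C1 * W + c1 * S2 - Fmin"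
        using bound[of n] F(1)[of n] by (simp add: sum_distrib_left)
      then show ?thesis using coeffs by (simp add: field_simps)
    qed
  qed
qed

text \<open>Multiplying the difference of the roots by \<open>sqrt y + sqrt z\<close> rationalises
  it, and this factor is at least \<open>sqrt e\<close>.\<close>

lemma abs_sqrt_diff_le:
  assumes "0 < e" "e \<le> y" "e \<le> z"
  shows "\<bar>sqrt y - sqrt z\<bar> \<le> \<bar>y - z\<bar> / sqrt e"
proof -
  have s: "0 < sqrt e" "sqrt e \<le> sqrt y" "0 \<le> sqrt z" using assms by auto
  have "\<bar>sqrt y - sqrt z\<bar> * sqrt e \<le> \<bar>sqrt y - sqrt z\<bar> * (sqrt y + sqrt z)"
    using s by (intro mult_left_mono add_increasing2) auto
  also have "\<dots> = \<bar>(sqrt y - sqrt z) * (sqrt y + sqrt z)\<bar>"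
    using s by (simp add: abs_mult)
  also have "\<dots> = \<bar>y - z\<bar>" using assms by (simp add: algebra_simps)
  finally show ?thesis using s by (simp add: field_simps)
qed

subsection \<open>History algebras and bounded random variables\<close>

lemma space_history_algebra [simp]: "space (history_algebra \<Omega> x k) = space \<Omega>"
  unfolding history_algebra_def by (rule space_measure_of) auto

lemma measurable_history_algebra:
  assumes "1 \<le> j" "j \<le> k"
  shows "x j \<in> borel_measurable (history_algebra \<Omega> x k)"
proof (rule measurableI)
  fix A :: "'b set" assume "A \<in> sets borel"
  then have "x j -` A \<inter> space \<Omega> \<in> {x j -` A \<inter> space \<Omega> | j A. j \<in> {1..k} \<and> A \<in> sets borel}"
    using assms by auto
  then show "x j -` A \<inter> space (history_algebra \<Omega> x k) \<in> sets (history_algebra \<Omega> x k)"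
    unfolding history_algebra_def by (auto simp: sets_measure_of_conv space_measure_of_conv)
qed simp

lemma subalgebra_history_algebra:
  assumes "\<And>j. 1 \<le> j \<Longrightarrow> j \<le> k \<Longrightarrow> x j \<in> borel_measurable \<Omega>"
  shows "subalgebra \<Omega> (history_algebra \<Omega> x k)"
proof -
  have "{x j -` A \<inter> space \<Omega> | j A. j \<in> {1..k} \<and> A \<in> sets borel} \<subseteq> sets \<Omega>"
    using assms by (auto intro: measurable_sets)
  then show ?thesis
    unfolding subalgebra_def space_history_algebra
    unfolding history_algebra_def
    by (auto simp: sets_measure_of_conv intro: sets.sigma_sets_subset[THEN subsetD] split: if_splits)
qed

text \<open>Only the space of the first argument enters the definition. A history built over a
  longer history is therefore the history over \<open>\<Omega>\<close>, which reduces monotonicity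
  to \<open>subalgebra_history_algebra\<close>.\<close>

lemma history_algebra_cong_space:
  "space M = space N \<Longrightarrow> history_algebra M x k = history_algebra N x k"
  by (simp add: history_algebra_def)

lemma history_algebra_mono:
  assumes "j \<le> k"
  shows "subalgebra (history_algebra \<Omega> x k) (history_algebra \<Omega> x j)"
proof -
  have "subalgebra (history_algebra \<Omega> x k) (history_algebra (history_algebra \<Omega> x k) x j)"
    using assms by (intro subalgebra_history_algebra measurable_history_algebra) auto
  then show ?thesis by (simp add: history_algebra_cong_space[of "history_algebra \<Omega> x k" \<Omega>])
qed

section \<open>Almost surely bounded random variables\<close>

context prob_space
begin

text \<open>A class of integrable variables closed under sums, differences and products, so that
  integrability of the expressions below follows from their shape alone.\<close>

definition bounded_rv :: "('a \<Rightarrow> real) \<Rightarrow> bool" where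
  "bounded_rv X \<longleftrightarrow> X \<in> borel_measurable M \<and> (\<exists>c. AE \<omega> in M. \<bar>X \<omega>\<bar> \<le> c)"

lemma bounded_rvI: "X \<in> borel_measurable M \<Longrightarrow> AE \<omega> in M. \<bar>X \<omega>\<bar> \<le> c \<Longrightarrow> bounded_rv X"
  by (auto simp: bounded_rv_def)

lemma bounded_rv_integrable: "bounded_rv X \<Longrightarrow> integrable M X"
  unfolding bounded_rv_def using integrable_const_bound[of X] by auto

lemma bounded_rv_const: "bounded_rv (\<lambda>\<omega>. c)"
  by (auto simp: bounded_rv_def)

lemma bounded_rv_add:
  assumes "bounded_rv X" "bounded_rv Y"
  shows "bounded_rv (\<lambda>\<omega>. X \<omega> + Y \<omega>)"
proof -
  obtain c d where "AE \<omega> in M. \<bar>X \<omega>\<bar> \<le> c" "AE \<omega> in M. \<bar>Y \<omega>\<bar> \<le> d"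
    using assms by (auto simp: bounded_rv_def)
  then have "AE \<omega> in M. \<bar>X \<omega> + Y \<omega>\<bar> \<le> c + d" by eventually_elim linarith
  then show ?thesis using assms by (auto simp: bounded_rv_def)
qed

lemma bounded_rv_mult:
  assumes "bounded_rv X" "bounded_rv Y"
  shows "bounded_rv (\<lambda>\<omega>. X \<omega> * Y \<omega>)"
proof -
  obtain c d where "AE \<omega> in M. \<bar>X \<omega>\<bar> \<le> c" "AE \<omega> in M. \<bar>Y \<omega>\<bar> \<le> d"
    using assms by (auto simp: bounded_rv_def)
  then have "AE \<omega> in M. \<bar>X \<omega> * Y \<omega>\<bar> \<le> c * d"
    by eventually_elim (auto simp: abs_mult intro: mult_mono')
  then show ?thesis using assms by (auto simp: bounded_rv_def)
qed

lemma bounded_rv_power: "bounded_rv X \<Longrightarrow> bounded_rv (\<lambda>\<omega>. X \<omega> ^ n)"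
  by (induction n) (auto intro: bounded_rv_const bounded_rv_mult)

lemma bounded_rv_diff: "bounded_rv X \<Longrightarrow> bounded_rv Y \<Longrightarrow> bounded_rv (\<lambda>\<omega>. X \<omega> - Y \<omega>)"
  using bounded_rv_add[OF _ bounded_rv_mult[OF bounded_rv_const[of "-1"]]] by simp

lemma bounded_rv_sum: "(\<And>i. i \<in> I \<Longrightarrow> bounded_rv (X i)) \<Longrightarrow> bounded_rv (\<lambda>\<omega>. \<Sum>i\<in>I. X i \<omega>)"
  by (induction I rule: infinite_finite_induct) (auto intro: bounded_rv_const bounded_rv_add)

lemmas bounded_rv_intros =
  bounded_rv_const bounded_rv_add bounded_rv_mult bounded_rv_power bounded_rv_diff bounded_rv_sum

end

subsection \<open>Adam\<close>

text \<open>The constants \<open>M\<close> and \<open>L\<close> are parameters here, so that the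
  explicit bounds below can refer to them.\<close>

locale adam = prob_space \<Omega> for \<Omega> :: "'w measure" +
  fixes f :: "real ^ 'd::finite \<Rightarrow> real"
    and grad_f :: "real ^ 'd \<Rightarrow> real ^ 'd"
    and g m v x :: "nat \<Rightarrow> 'w \<Rightarrow> real ^ 'd"
    and x1 :: "real ^ 'd"
    and \<eta> \<beta> \<theta> :: "nat \<Rightarrow> real"
    and \<epsilon> b M L :: real
  assumes grad: "\<And>y. GDERIV f y :> grad_f y"
    and eta_pos: "\<And>k. k \<ge> 1 \<Longrightarrow> \<eta> k > 0" and eps_pos: "\<epsilon> > 0"
    and beta: "\<And>k. k \<ge> 1 \<Longrightarrow> 0 \<le> \<beta> k" "\<And>k. k \<ge> 1 \<Longrightarrow> \<beta> k \<le> b" "b < 1"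
    and theta: "\<And>k. k \<ge> 1 \<Longrightarrow> 0 < \<theta> k" "\<And>k. k \<ge> 1 \<Longrightarrow> \<theta> k < 1"
    and g_measurable: "\<And>k. k \<ge> 1 \<Longrightarrow> g k \<in> borel_measurable \<Omega>"
    and trajectory: "\<And>\<omega>. \<omega> \<in> space \<Omega> \<Longrightarrow>
      adam_trajectory \<eta> \<epsilon> \<beta> \<theta> x1 (\<lambda>k. g k \<omega>) (\<lambda>k. m k \<omega>) (\<lambda>k. v k \<omega>) (\<lambda>k. x k \<omega>)"
    and unbiased: "\<And>k. k \<ge> 1 \<Longrightarrow>
      AE \<omega> in \<Omega>. vec_cond_exp \<Omega> (history_algebra \<Omega> x k) (g k) \<omega> = grad_f (x k \<omega>)"
    and M_pos: "0 < M" and g_bounded: "\<And>k. k \<ge> 1 \<Longrightarrow> AE \<omega> in \<Omega>. norm (g k \<omega>) \<le> M"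
    and L_pos: "0 < L" and smooth: "\<And>y z. norm (grad_f y - grad_f z) \<le> L * norm (y - z)"
begin

section \<open>Denominators, updates and gradients by coordinate\<close>

definition "denom n i \<omega> = sqrt (v n \<omega> $ i + \<epsilon>)"
definition "update n i \<omega> = m n \<omega> $ i / denom n i \<omega>"

definition "cdenom n i = real_cond_exp \<Omega> (history_algebra \<Omega> x (Suc n)) (denom n i)"
definition "gr n i \<omega> = grad_f (x (Suc n) \<omega>) $ i"

lemma m_0: "\<omega> \<in> space \<Omega> \<Longrightarrow> m 0 \<omega> = 0"
  and v_0: "\<omega> \<in> space \<Omega> \<Longrightarrow> v 0 \<omega> = 0"
  and x_1: "\<omega> \<in> space \<Omega> \<Longrightarrow> x (Suc 0) \<omega> = x1"
  using trajectory[of \<omega>] by (auto simp: adam_trajectory_def)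

lemma m_Suc: "\<omega> \<in> space \<Omega> \<Longrightarrow> m (Suc n) \<omega> = \<beta> (Suc n) *\<^sub>R m n \<omega> + (1 - \<beta> (Suc n)) *\<^sub>R g (Suc n) \<omega>"
  and v_Suc: "\<omega> \<in> space \<Omega> \<Longrightarrow>
    v (Suc n) \<omega> = \<theta> (Suc n) *\<^sub>R v n \<omega> + (1 - \<theta> (Suc n)) *\<^sub>R (\<chi> i. (g (Suc n) \<omega> $ i)\<^sup>2)"
  and x_Suc: "\<omega> \<in> space \<Omega> \<Longrightarrow>
    x (Suc (Suc n)) \<omega> = x (Suc n) \<omega> - \<eta> (Suc n) *\<^sub>R (\<chi> i. update (Suc n) i \<omega>)"
  using trajectory[of \<omega>] by (auto simp: adam_trajectory_def update_def denom_def)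

section \<open>Measurability on the whole space and in the histories\<close>

lemma g_Suc_measurable [measurable]: "g (Suc n) \<in> borel_measurable \<Omega>"
  by (simp add: g_measurable)

lemma vec_measurable [measurable]: "(\<lambda>\<omega>. X \<omega> $ i) \<in> borel_measurable N"
  if "X \<in> borel_measurable N" for X :: "'w \<Rightarrow> real ^ 'd"
proof -
  have "(\<lambda>\<omega>. X \<omega> \<bullet> axis i 1) \<in> borel_measurable N" using that by measurable
  then show ?thesis by (simp add: inner_axis)
qed

lemma vec_lambda_measurable [measurable]: "(\<lambda>\<omega>. \<chi> i. X i \<omega>) \<in> borel_measurable N"
  if "\<And>i. X i \<in> borel_measurable N" for X :: "'d \<Rightarrow> 'w \<Rightarrow> real"
  using that by (subst borel_measurable_euclidean_space) (auto simp: Basis_vec_def inner_axis)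

text \<open>The recursions are known only on the space of \<open>\<Omega>\<close>, hence the passage
  through \<open>measurable_cong\<close>.\<close>

lemma m_measurable [measurable]: "m n \<in> borel_measurable \<Omega>"
proof (induction n)
  case 0
  then show ?case by (subst measurable_cong[where g = "\<lambda>_. 0"]) (auto simp: m_0)
next
  case (Suc n)
  note [measurable] = Suc
  show ?case by (subst measurable_cong[OF m_Suc]) measurable
qed

lemma v_measurable [measurable]: "v n \<in> borel_measurable \<Omega>"
proof (induction n)
  case 0
  then show ?case by (subst measurable_cong[where g = "\<lambda>_. 0"]) (auto simp: v_0)
next
  case (Suc n)
  note [measurable] = Suc
  show ?case by (subst measurable_cong[OF v_Suc]) (measurable)
qed

lemma denom_measurable [measurable]: "denom n i \<in> borel_measurable \<Omega>"
  unfolding denom_def by measurable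

lemma update_measurable [measurable]: "update n i \<in> borel_measurable \<Omega>"
  unfolding update_def by measurable

lemma x_measurable [measurable]: "x (Suc n) \<in> borel_measurable \<Omega>"
proof (induction n)
  case 0
  then show ?case by (subst measurable_cong[where g = "\<lambda>_. x1"]) (auto simp: x_1)
next
  case (Suc n)
  note [measurable] = Suc
  show ?case by (subst measurable_cong[OF x_Suc]) measurable
qed

lemma subalgebra_history: "subalgebra \<Omega> (history_algebra \<Omega> x k)"
proof (rule subalgebra_history_algebra)
  fix j :: nat assume "1 \<le> j"
  then show "x j \<in> borel_measurable \<Omega>" by (cases j) auto
qed

lemma history: "sigma_finite_subalgebra \<Omega> (history_algebra \<Omega> x k)"
  by (intro finite_measure_subalgebra_is_sigma_finite finite_measure_subalgebra.intro
      finite_measure_subalgebra_axioms.intro subalgebra_history) unfold_locales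

lemma measurable_from_history: "X \<in> borel_measurable (history_algebra \<Omega> x k) \<Longrightarrow> X \<in> borel_measurable \<Omega>"
  by (rule measurable_from_subalg[OF subalgebra_history])

lemma continuous_grad: "continuous_on UNIV grad_f"
proof (rule lipschitz_on_continuous_on)
  show "L-lipschitz_on UNIV grad_f"
    using smooth L_pos by (auto intro!: lipschitz_onI simp: dist_norm)
qed

lemma continuous_f: "continuous_on UNIV f"
  using grad unfolding gderiv_def
  by (meson continuous_at_imp_continuous_on has_derivative_continuous)

lemma gr_history: "gr n i \<in> borel_measurable (history_algebra \<Omega> x (Suc n))"
proof -
  note [measurable] = measurable_history_algebra[of "Suc n" "Suc n" x \<Omega>] borel_measurable_continuous_onI[OF continuous_grad]
  show ?thesis unfolding gr_def by measurable
qed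

lemma cdenom_history: "cdenom n i \<in> borel_measurable (history_algebra \<Omega> x (Suc n))"
  unfolding cdenom_def by simp

text \<open>For positive \<open>n\<close> the update is the difference of two consecutive iterates
  divided by the positive step size, so the iterates reveal it. For \<open>n = 0\<close> it vanishes
  because the momentum starts at zero.\<close>

lemma update_history: "update n i \<in> borel_measurable (history_algebra \<Omega> x (Suc n))"
proof (cases n)
  case 0
  then show ?thesis
    by (subst measurable_cong[where g = "\<lambda>_. 0"]) (auto simp: update_def m_0)
next
  case (Suc k)
  have [measurable]: "x n \<in> borel_measurable (history_algebra \<Omega> x (Suc n))"
    "x (Suc n) \<in> borel_measurable (history_algebra \<Omega> x (Suc n))"
    using Suc by (auto intro: measurable_history_algebra)
  have "update n i \<omega> = (x n \<omega> $ i - x (Suc n) \<omega> $ i) / \<eta> n" if "\<omega> \<in> space \<Omega>" for \<omega>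
    using x_Suc[OF that, of k] eta_pos[of "Suc k"] Suc by simp
  moreover have "(\<lambda>\<omega>. (x n \<omega> $ i - x (Suc n) \<omega> $ i) / \<eta> n) \<in> borel_measurable (history_algebra \<Omega> x (Suc n))"
    by measurable
  ultimately show ?thesis
    by (subst measurable_cong[where g = "\<lambda>\<omega>. (x n \<omega> $ i - x (Suc n) \<omega> $ i) / \<eta> n"]) auto
qed

lemma gr_measurable [measurable]: "gr n i \<in> borel_measurable \<Omega>"
  and cdenom_measurable [measurable]: "cdenom n i \<in> borel_measurable \<Omega>"
  by (rule measurable_from_history, rule gr_history cdenom_history)+

lemma f_measurable [measurable]: "(\<lambda>\<omega>. f (x (Suc n) \<omega>)) \<in> borel_measurable \<Omega>"
  using borel_measurable_continuous_onI[OF continuous_f] by measurable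

section \<open>Almost sure bounds: \<open>smax\<close> for denominators, \<open>umax\<close> for
  updates\<close>

definition "smax = sqrt (M\<^sup>2 + \<epsilon>)"
definition "umax = M / sqrt \<epsilon>"

lemma smax_pos: "0 < smax" and umax_pos: "0 < umax"
  unfolding smax_def umax_def using eps_pos M_pos by (auto intro: add_nonneg_pos)

lemma v_nonneg: "\<omega> \<in> space \<Omega> \<Longrightarrow> 0 \<le> v n \<omega> $ i"
proof (induction n)
  case (Suc n)
  then show ?case using theta[of "Suc n"] by (simp add: v_Suc)
qed (simp add: v_0)

lemma denom_ge: "\<omega> \<in> space \<Omega> \<Longrightarrow> sqrt \<epsilon> \<le> denom n i \<omega>"
  using v_nonneg by (simp add: denom_def)

lemma denom_pos: "\<omega> \<in> space \<Omega> \<Longrightarrow> 0 < denom n i \<omega>"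
  using denom_ge[of \<omega> n i] eps_pos by (meson less_le_trans real_sqrt_gt_zero)

lemma denom_update: "\<omega> \<in> space \<Omega> \<Longrightarrow> denom n i \<omega> * update n i \<omega> = m n \<omega> $ i"
  using denom_pos[of \<omega> n i] by (simp add: update_def)

text \<open>A countable intersection puts the gradient bounds of all steps into one event of full
  measure, on which the moments and iterates can be estimated path by path.\<close>

lemma AE_good: "AE \<omega> in \<Omega>. \<forall>n. norm (g (Suc n) \<omega>) \<le> M"
  unfolding AE_all_countable by (simp add: g_bounded)

context
  fixes \<omega> assumes \<omega>: "\<omega> \<in> space \<Omega>" and good: "\<forall>n. norm (g (Suc n) \<omega>) \<le> M"
begin

lemma g_comp_le: "\<bar>g (Suc n) \<omega> $ i\<bar> \<le> M"
  using good component_le_norm_cart order_trans by blast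

lemma m_le: "\<bar>m n \<omega> $ i\<bar> \<le> M"
proof (induction n)
  case (Suc n)
  have \<beta>: "0 \<le> \<beta> (Suc n)" "\<beta> (Suc n) \<le> 1" using beta(1,2)[of "Suc n"] beta(3) by auto
  have "\<bar>m (Suc n) \<omega> $ i\<bar> \<le> \<beta> (Suc n) * \<bar>m n \<omega> $ i\<bar> + (1 - \<beta> (Suc n)) * \<bar>g (Suc n) \<omega> $ i\<bar>"
    using \<beta> by (simp add: m_Suc[OF \<omega>]) (metis abs_triangle_ineq abs_mult abs_of_nonneg diff_ge_0_iff_ge)
  also have "\<dots> \<le> \<beta> (Suc n) * M + (1 - \<beta> (Suc n)) * M"
    using \<beta> by (intro add_mono mult_left_mono Suc g_comp_le) auto
  finally show ?case by (simp add: algebra_simps)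
qed (use \<omega> M_pos in \<open>simp add: m_0\<close>)

lemma g_comp_sq_le: "(g (Suc n) \<omega> $ i)\<^sup>2 \<le> M\<^sup>2"
  using power_mono[OF g_comp_le[of n i], of 2] by simp

lemma v_le: "v n \<omega> $ i \<le> M\<^sup>2"
proof (induction n)
  case (Suc n)
  have "v (Suc n) \<omega> $ i \<le> \<theta> (Suc n) * M\<^sup>2 + (1 - \<theta> (Suc n)) * M\<^sup>2"
    using theta[of "Suc n"] unfolding v_Suc[OF \<omega>]
    by (auto intro!: add_mono mult_left_mono Suc g_comp_sq_le)
  then show ?case by (simp add: algebra_simps)
qed (use \<omega> in \<open>simp add: v_0\<close>)

lemma denom_le: "denom n i \<omega> \<le> smax"
  unfolding denom_def smax_def using v_le by simp

lemma update_le: "\<bar>update n i \<omega>\<bar> \<le> umax"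
  unfolding update_def umax_def abs_divide
  using m_le order_trans[OF denom_ge[OF \<omega>] abs_ge_self] eps_pos M_pos by (intro frac_le) auto

text \<open>The second moment moves by \<open>1 - \<theta> (Suc n)\<close> times a difference of two
  numbers in the interval from 0 to \<open>M\<^sup>2\<close>, and the root is Lipschitz above
  \<open>\<epsilon>\<close>.\<close>

lemma denom_diff_le: "\<bar>denom (Suc n) i \<omega> - denom n i \<omega>\<bar> \<le> M\<^sup>2 / sqrt \<epsilon> * (1 - \<theta> (Suc n))"
proof -
  have \<theta>: "0 \<le> 1 - \<theta> (Suc n)" using theta[of "Suc n"] by simp
  have "v (Suc n) \<omega> $ i - v n \<omega> $ i = (1 - \<theta> (Suc n)) * ((g (Suc n) \<omega> $ i)\<^sup>2 - v n \<omega> $ i)"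
    by (simp add: v_Suc[OF \<omega>] algebra_simps)
  then have "\<bar>v (Suc n) \<omega> $ i - v n \<omega> $ i\<bar> = (1 - \<theta> (Suc n)) * \<bar>(g (Suc n) \<omega> $ i)\<^sup>2 - v n \<omega> $ i\<bar>"
    using \<theta> by (simp add: abs_mult)
  also have "\<dots> \<le> (1 - \<theta> (Suc n)) * M\<^sup>2"
  proof (rule mult_left_mono[OF _ \<theta>])
    show "\<bar>(g (Suc n) \<omega> $ i)\<^sup>2 - v n \<omega> $ i\<bar> \<le> M\<^sup>2"
      using g_comp_sq_le[of n i] v_le[of n i] v_nonneg[OF \<omega>, of n i] zero_le_power2[of "g (Suc n) \<omega> $ i"]
      by linarith
  qed
  finally have "\<bar>v (Suc n) \<omega> $ i - v n \<omega> $ i\<bar> / sqrt \<epsilon> \<le> (1 - \<theta> (Suc n)) * M\<^sup>2 / sqrt \<epsilon>"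
    using eps_pos by (intro divide_right_mono) auto
  moreover have "\<bar>denom (Suc n) i \<omega> - denom n i \<omega>\<bar> \<le> \<bar>v (Suc n) \<omega> $ i - v n \<omega> $ i\<bar> / sqrt \<epsilon>"
    unfolding denom_def
    using abs_sqrt_diff_le[of \<epsilon> "v (Suc n) \<omega> $ i + \<epsilon>" "v n \<omega> $ i + \<epsilon>"] eps_pos v_nonneg[OF \<omega>] by simp
  ultimately show ?thesis by (simp add: mult_ac)
qed

lemma step_le: "norm (x (Suc (Suc n)) \<omega> - x (Suc n) \<omega>) \<le> \<eta> (Suc n) * (CARD('d) * umax)"
proof -
  have "norm (\<chi> i. update (Suc n) i \<omega>) \<le> (\<Sum>i\<in>UNIV. \<bar>update (Suc n) i \<omega>\<bar>)"
    using norm_le_l1_cart[of "\<chi> i. update (Suc n) i \<omega>"] by simp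
  also have "\<dots> \<le> (\<Sum>i\<in>(UNIV::'d set). umax)" by (intro sum_mono update_le)
  finally show ?thesis using eta_pos[of "Suc n"] by (simp add: x_Suc[OF \<omega>])
qed

text \<open>Each iterate stays in a deterministic ball around \<open>x1\<close>; this later gives
  boundedness of the objective at a fixed step.\<close>

lemma dist_start_le: "norm (x (Suc n) \<omega> - x1) \<le> (\<Sum>k<n. \<eta> (Suc k) * (CARD('d) * umax))"
proof (induction n)
  case (Suc n)
  then show ?case using step_le[of n] norm_triangle_ineq[of "x (Suc (Suc n)) \<omega> - x (Suc n) \<omega>" "x (Suc n) \<omega> - x1"] by simp
qed (simp add: x_1[OF \<omega>])

end

section \<open>Bounds for conditional denominators and true gradients\<close>

lemma AE_denom_le: "AE \<omega> in \<Omega>. \<bar>denom n i \<omega>\<bar> \<le> smax"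
  using AE_good AE_space by eventually_elim (use denom_le denom_pos in \<open>force simp: abs_of_pos\<close>)

lemma AE_update_le: "AE \<omega> in \<Omega>. \<bar>update n i \<omega>\<bar> \<le> umax"
  using AE_good AE_space by eventually_elim (use update_le in auto)

lemma integrable_denom: "integrable \<Omega> (denom n i)"
  using AE_denom_le by (intro integrable_const_bound) auto

lemma AE_cdenom: "AE \<omega> in \<Omega>. sqrt \<epsilon> \<le> cdenom n i \<omega> \<and> cdenom n i \<omega> \<le> smax"
proof -
  have "AE \<omega> in \<Omega>. sqrt \<epsilon> \<le> denom n i \<omega>" using AE_space by eventually_elim (rule denom_ge)
  moreover have "AE \<omega> in \<Omega>. denom n i \<omega> \<le> smax" using AE_denom_le[of n i] by eventually_elim auto
  ultimately show ?thesis
    using sigma_finite_subalgebra.real_cond_exp_ge_c[OF history integrable_denom]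
      sigma_finite_subalgebra.real_cond_exp_le_c[OF history integrable_denom]
    unfolding cdenom_def by (auto simp: AE_conj_iff)
qed

lemma AE_g_comp_le: "AE \<omega> in \<Omega>. \<bar>g (Suc n) \<omega> $ i\<bar> \<le> M"
  using AE_good AE_space by eventually_elim (rule g_comp_le)

lemma integrable_g: "integrable \<Omega> (\<lambda>\<omega>. g (Suc n) \<omega> $ i)"
  using AE_g_comp_le by (intro integrable_const_bound) auto

lemma AE_cond_g: "AE \<omega> in \<Omega>. real_cond_exp \<Omega> (history_algebra \<Omega> x (Suc n)) (\<lambda>\<omega>. g (Suc n) \<omega> $ i) \<omega> = gr n i \<omega>"
  using unbiased[of "Suc n"] by (auto simp: vec_cond_exp_def vec_eq_iff gr_def elim!: eventually_mono)

text \<open>The true gradient along the iterates inherits the bound of the stochastic one, being its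
  conditional expectation.\<close>

lemma AE_gr_le: "AE \<omega> in \<Omega>. \<bar>gr n i \<omega>\<bar> \<le> M"
proof -
  have "AE \<omega> in \<Omega>. g (Suc n) \<omega> $ i \<le> M" "AE \<omega> in \<Omega>. -M \<le> g (Suc n) \<omega> $ i"
    using AE_g_comp_le[of n i] by auto
  then have "AE \<omega> in \<Omega>. real_cond_exp \<Omega> (history_algebra \<Omega> x (Suc n)) (\<lambda>\<omega>. g (Suc n) \<omega> $ i) \<omega> \<le> M"
    "AE \<omega> in \<Omega>. -M \<le> real_cond_exp \<Omega> (history_algebra \<Omega> x (Suc n)) (\<lambda>\<omega>. g (Suc n) \<omega> $ i) \<omega>"
    by - (rule sigma_finite_subalgebra.real_cond_exp_le_c[OF history integrable_g]
      sigma_finite_subalgebra.real_cond_exp_ge_c[OF history integrable_g]; assumption)+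
  with AE_cond_g[of n i] show ?thesis by eventually_elim auto
qed

lemma AE_norm_grad_le: "AE \<omega> in \<Omega>. norm (grad_f (x (Suc n) \<omega>)) \<le> CARD('d) * M"
proof -
  have "AE \<omega> in \<Omega>. \<forall>i. \<bar>gr n i \<omega>\<bar> \<le> M"
    using AE_finite_allI[OF finite_class.finite_UNIV AE_gr_le] by simp
  then show ?thesis
  proof eventually_elim
    case (elim \<omega>)
    have "norm (grad_f (x (Suc n) \<omega>)) \<le> (\<Sum>i\<in>UNIV. \<bar>gr n i \<omega>\<bar>)"
      unfolding gr_def by (rule norm_le_l1_cart)
    also have "\<dots> \<le> (\<Sum>i\<in>(UNIV::'d set). M)" by (intro sum_mono) (use elim in auto)
    finally show ?case by simp
  qed
qed

section \<open>Integrable products and conditioning on the history\<close>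

lemma bounded_rv_denom: "bounded_rv (denom n i)"
  and bounded_rv_update: "bounded_rv (update n i)"
  and bounded_rv_gr: "bounded_rv (gr n i)"
  and bounded_rv_g: "bounded_rv (\<lambda>\<omega>. g (Suc n) \<omega> $ i)"
  by (rule bounded_rvI[OF _ AE_denom_le] bounded_rvI[OF _ AE_update_le] bounded_rvI[OF _ AE_gr_le]
      bounded_rvI[OF _ AE_g_comp_le]; measurable)+

text \<open>Division by \<open>cdenom\<close> is written as multiplication with its inverse, bounded
  because \<open>cdenom\<close> is at least \<open>sqrt \<epsilon>\<close>; the closure rules for
  products then apply.\<close>

lemma bounded_rv_cdenom: "bounded_rv (cdenom n i)"
  and bounded_rv_inverse_cdenom: "bounded_rv (\<lambda>\<omega>. inverse (cdenom n i \<omega>))"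
proof -
  have s: "0 < sqrt \<epsilon>" using eps_pos by simp
  have "AE \<omega> in \<Omega>. \<bar>cdenom n i \<omega>\<bar> \<le> smax \<and> \<bar>inverse (cdenom n i \<omega>)\<bar> \<le> inverse (sqrt \<epsilon>)"
    using AE_cdenom[of n i]
  proof eventually_elim
    case (elim \<omega>)
    then have "0 < cdenom n i \<omega>" "inverse (cdenom n i \<omega>) \<le> inverse (sqrt \<epsilon>)"
      using s by (linarith, intro le_imp_inverse_le) auto
    with elim show ?case by (simp add: abs_of_pos)
  qed
  then show "bounded_rv (cdenom n i)" "bounded_rv (\<lambda>\<omega>. inverse (cdenom n i \<omega>))"
    unfolding bounded_rv_def AE_conj_iff by auto
qed

lemmas bounded_rv_adam = bounded_rv_intros bounded_rv_denom bounded_rv_update bounded_rv_gr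
  bounded_rv_g bounded_rv_cdenom bounded_rv_inverse_cdenom

lemma integral_mult_cond:
  assumes Y: "Y \<in> borel_measurable (history_algebra \<Omega> x k)" "bounded_rv Y" and Z: "bounded_rv Z"
  shows "(\<integral>\<omega>. Y \<omega> * real_cond_exp \<Omega> (history_algebra \<Omega> x k) Z \<omega> \<partial>\<Omega>) = (\<integral>\<omega>. Y \<omega> * Z \<omega> \<partial>\<Omega>)"
  using assms by (intro sigma_finite_subalgebra.real_cond_exp_intg(2)[OF history]
      bounded_rv_integrable bounded_rv_mult) (auto simp: bounded_rv_def)

lemma integral_mult_cdenom:
  assumes "Y \<in> borel_measurable (history_algebra \<Omega> x (Suc n))" "bounded_rv Y"
  shows "(\<integral>\<omega>. Y \<omega> * cdenom n i \<omega> \<partial>\<Omega>) = (\<integral>\<omega>. Y \<omega> * denom n i \<omega> \<partial>\<Omega>)"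
  unfolding cdenom_def by (intro integral_mult_cond assms bounded_rv_denom)

lemma history_Suc:
  "Y \<in> borel_measurable (history_algebra \<Omega> x n) \<Longrightarrow> Y \<in> borel_measurable (history_algebra \<Omega> x (Suc n))"
  by (rule measurable_from_subalg[OF history_algebra_mono]) simp_all

text \<open>Write the momentum as \<open>update\<close> times \<open>denom\<close>. All other
  factors are known given the iterates up to \<open>x (Suc k)\<close>, also for
  \<open>k = Suc n\<close> as histories grow, so conditioning replaces \<open>denom\<close> by
  \<open>cdenom\<close>.\<close>

lemma integral_mult_m:
  fixes n k :: nat and i :: 'd
  assumes "k = n \<or> k = Suc n"
  defines "Y \<equiv> \<lambda>\<omega>. gr n i \<omega> * inverse (cdenom n i \<omega>)"
  shows "(\<integral>\<omega>. Y \<omega> * m k \<omega> $ i \<partial>\<Omega>) = (\<integral>\<omega>. Y \<omega> * update k i \<omega> * cdenom k i \<omega> \<partial>\<Omega>)"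
proof -
  have "gr n i \<in> borel_measurable (history_algebra \<Omega> x (Suc k))"
    "cdenom n i \<in> borel_measurable (history_algebra \<Omega> x (Suc k))"
    using assms(1) by (auto intro: gr_history cdenom_history history_Suc)
  note [measurable] = this update_history[of k i]
  have "(\<integral>\<omega>. Y \<omega> * update k i \<omega> * cdenom k i \<omega> \<partial>\<Omega>) = (\<integral>\<omega>. Y \<omega> * update k i \<omega> * denom k i \<omega> \<partial>\<Omega>)"
  proof (rule integral_mult_cdenom)
    show "(\<lambda>\<omega>. Y \<omega> * update k i \<omega>) \<in> borel_measurable (history_algebra \<Omega> x (Suc k))"
      unfolding Y_def by measurable
    show "bounded_rv (\<lambda>\<omega>. Y \<omega> * update k i \<omega>)"
      unfolding Y_def by (intro bounded_rv_adam)
  qed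
  also have "\<dots> = (\<integral>\<omega>. Y \<omega> * m k \<omega> $ i \<partial>\<Omega>)"
    by (intro Bochner_Integration.integral_cong refl)
       (simp add: denom_update[symmetric] mult_ac)
  finally show ?thesis ..
qed

section \<open>The energy inequality in one coordinate\<close>

definition "acoef = (1 - b) / (2 * smax)"
text \<open>\<open>acoef\<close> is half of the coefficient \<open>(1 - b) / smax\<close> available
  in front of the squared gradient; the other half pays for AM-GM. \<open>ecoef\<close> is the
  matching AM-GM constant for the squared change of \<open>cdenom\<close>.\<close>

definition "ecoef = (umax / sqrt \<epsilon>)\<^sup>2 / (4 * acoef)"

lemma acoef_pos: "0 < acoef"
  unfolding acoef_def using smax_pos beta(3) by simp

lemma component_energy:
  "\<beta> (Suc n) * (\<integral>\<omega>. gr n i \<omega> * update n i \<omega> \<partial>\<Omega>) + acoef * (\<integral>\<omega>. (gr n i \<omega>)\<^sup>2 \<partial>\<Omega>)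
    - ecoef * (\<integral>\<omega>. (cdenom (Suc n) i \<omega> - cdenom n i \<omega>)\<^sup>2 \<partial>\<Omega>)
   \<le> (\<integral>\<omega>. gr n i \<omega> * update (Suc n) i \<omega> \<partial>\<Omega>)"
proof -
  \<comment> \<open>Dividing by the conditional denominator keeps the test function measurable in
    the history up to \<open>x (Suc n)\<close>.\<close>
  define Y where "Y = (\<lambda>\<omega>. gr n i \<omega> * inverse (cdenom n i \<omega>))"
  have bY: "bounded_rv Y" unfolding Y_def by (intro bounded_rv_adam)
  note bi = bounded_rv_adam bY
  have "AE \<omega> in \<Omega>. cdenom n i \<omega> \<noteq> 0"
    using AE_cdenom[of n i] by eventually_elim (use eps_pos in \<open>auto simp: not_le\<close>)
  then have Yc: "AE \<omega> in \<Omega>. Y \<omega> * cdenom n i \<omega> = gr n i \<omega>"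
    by eventually_elim (simp add: Y_def)
  have bm: "bounded_rv (\<lambda>\<omega>. m k \<omega> $ i)" for k
  proof (rule bounded_rvI)
    show "AE \<omega> in \<Omega>. \<bar>m k \<omega> $ i\<bar> \<le> M"
      using AE_good AE_space by eventually_elim (rule m_le)
  qed measurable
  \<comment> \<open>For the old momentum the conditional denominator cancels exactly against the one
    in \<open>Y\<close>.\<close>
  have 1: "(\<integral>\<omega>. Y \<omega> * m n \<omega> $ i \<partial>\<Omega>) = (\<integral>\<omega>. gr n i \<omega> * update n i \<omega> \<partial>\<Omega>)"
  proof -
    have "(\<integral>\<omega>. Y \<omega> * m n \<omega> $ i \<partial>\<Omega>) = (\<integral>\<omega>. Y \<omega> * update n i \<omega> * cdenom n i \<omega> \<partial>\<Omega>)"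
      unfolding Y_def by (rule integral_mult_m) simp
    also have "\<dots> = (\<integral>\<omega>. gr n i \<omega> * update n i \<omega> \<partial>\<Omega>)"
      using Yc by (intro integral_cong_AE) (auto simp: Y_def mult_ac elim!: eventually_mono)
    finally show ?thesis .
  qed
  have 2: "(\<integral>\<omega>. Y \<omega> * g (Suc n) \<omega> $ i \<partial>\<Omega>) = (\<integral>\<omega>. Y \<omega> * gr n i \<omega> \<partial>\<Omega>)"
  proof -
    note [measurable] = gr_history[of n i] cdenom_history[of n i]
    have "(\<integral>\<omega>. Y \<omega> * g (Suc n) \<omega> $ i \<partial>\<Omega>)
      = (\<integral>\<omega>. Y \<omega> * real_cond_exp \<Omega> (history_algebra \<Omega> x (Suc n)) (\<lambda>\<omega>. g (Suc n) \<omega> $ i) \<omega> \<partial>\<Omega>)"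
    proof (rule integral_mult_cond[symmetric])
      show "Y \<in> borel_measurable (history_algebra \<Omega> x (Suc n))" unfolding Y_def by measurable
    qed (intro bi)+
    also have "\<dots> = (\<integral>\<omega>. Y \<omega> * gr n i \<omega> \<partial>\<Omega>)"
    proof (rule integral_cong_AE)
      show "(\<lambda>\<omega>. Y \<omega> * gr n i \<omega>) \<in> borel_measurable \<Omega>" unfolding Y_def by measurable
      show "(\<lambda>\<omega>. Y \<omega> * real_cond_exp \<Omega> (history_algebra \<Omega> x (Suc n)) (\<lambda>\<omega>. g (Suc n) \<omega> $ i) \<omega>)
        \<in> borel_measurable \<Omega>" unfolding Y_def by measurable
      show "AE \<omega> in \<Omega>. Y \<omega> * real_cond_exp \<Omega> (history_algebra \<Omega> x (Suc n)) (\<lambda>\<omega>. g (Suc n) \<omega> $ i) \<omega>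
        = Y \<omega> * gr n i \<omega>"
        using AE_cond_g[of n i] by eventually_elim simp
    qed
    finally show ?thesis .
  qed
  have 3: "(\<integral>\<omega>. Y \<omega> * m (Suc n) \<omega> $ i \<partial>\<Omega>)
    = \<beta> (Suc n) * (\<integral>\<omega>. Y \<omega> * m n \<omega> $ i \<partial>\<Omega>) + (1 - \<beta> (Suc n)) * (\<integral>\<omega>. Y \<omega> * g (Suc n) \<omega> $ i \<partial>\<Omega>)"
  proof -
    have "(\<integral>\<omega>. Y \<omega> * m (Suc n) \<omega> $ i \<partial>\<Omega>)
      = (\<integral>\<omega>. \<beta> (Suc n) * (Y \<omega> * m n \<omega> $ i) + (1 - \<beta> (Suc n)) * (Y \<omega> * g (Suc n) \<omega> $ i) \<partial>\<Omega>)"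
      by (intro Bochner_Integration.integral_cong refl) (simp add: m_Suc algebra_simps)
    also have "\<dots> = \<beta> (Suc n) * (\<integral>\<omega>. Y \<omega> * m n \<omega> $ i \<partial>\<Omega>) + (1 - \<beta> (Suc n)) * (\<integral>\<omega>. Y \<omega> * g (Suc n) \<omega> $ i \<partial>\<Omega>)"
      by (subst Bochner_Integration.integral_add)
         (auto intro!: bi bm bounded_rv_integrable)
    finally show ?thesis .
  qed
  let ?\<Delta> = "\<lambda>\<omega>. cdenom (Suc n) i \<omega> - cdenom n i \<omega>"
  \<comment> \<open>For the new momentum the factor is \<open>cdenom (Suc n)\<close>, while
    \<open>Y\<close> divides by \<open>cdenom n\<close>; the mismatch produces
    \<open>?\<Delta>\<close>.\<close>
  have 4: "(\<integral>\<omega>. Y \<omega> * m (Suc n) \<omega> $ i \<partial>\<Omega>)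
     = (\<integral>\<omega>. gr n i \<omega> * update (Suc n) i \<omega> \<partial>\<Omega>) + (\<integral>\<omega>. Y \<omega> * update (Suc n) i \<omega> * ?\<Delta> \<omega> \<partial>\<Omega>)"
  proof -
    have "(\<integral>\<omega>. Y \<omega> * m (Suc n) \<omega> $ i \<partial>\<Omega>) = (\<integral>\<omega>. Y \<omega> * update (Suc n) i \<omega> * cdenom (Suc n) i \<omega> \<partial>\<Omega>)"
      unfolding Y_def by (rule integral_mult_m) simp
    also have "\<dots> = (\<integral>\<omega>. gr n i \<omega> * update (Suc n) i \<omega> + Y \<omega> * update (Suc n) i \<omega> * ?\<Delta> \<omega> \<partial>\<Omega>)"
    proof (rule integral_cong_AE)
      show "AE \<omega> in \<Omega>. Y \<omega> * update (Suc n) i \<omega> * cdenom (Suc n) i \<omega>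
        = gr n i \<omega> * update (Suc n) i \<omega> + Y \<omega> * update (Suc n) i \<omega> * ?\<Delta> \<omega>"
        using Yc
      proof eventually_elim
        case (elim \<omega>)
        have "Y \<omega> * update (Suc n) i \<omega> * ?\<Delta> \<omega>
          = Y \<omega> * update (Suc n) i \<omega> * cdenom (Suc n) i \<omega> - (Y \<omega> * cdenom n i \<omega>) * update (Suc n) i \<omega>"
          by (simp add: algebra_simps)
        then show ?case unfolding elim by simp
      qed
    qed (unfold Y_def, measurable)
    also have "\<dots> = (\<integral>\<omega>. gr n i \<omega> * update (Suc n) i \<omega> \<partial>\<Omega>) + (\<integral>\<omega>. Y \<omega> * update (Suc n) i \<omega> * ?\<Delta> \<omega> \<partial>\<Omega>)"
      by (intro Bochner_Integration.integral_add bounded_rv_integrable bi)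
    finally show ?thesis .
  qed
  \<comment> \<open>AM-GM with \<open>\<bar>gr n i \<omega>\<bar>\<close> as one factor; the other
    is \<open>\<bar>?\<Delta> \<omega>\<bar>\<close> times the bound
    \<open>umax / sqrt \<epsilon>\<close> for update over denominator.\<close>
  have 5: "(\<integral>\<omega>. Y \<omega> * update (Suc n) i \<omega> * ?\<Delta> \<omega> \<partial>\<Omega>)
    \<le> acoef * (\<integral>\<omega>. (gr n i \<omega>)\<^sup>2 \<partial>\<Omega>) + ecoef * (\<integral>\<omega>. (?\<Delta> \<omega>)\<^sup>2 \<partial>\<Omega>)"
  proof -
    have "(\<integral>\<omega>. Y \<omega> * update (Suc n) i \<omega> * ?\<Delta> \<omega> \<partial>\<Omega>)
      \<le> (\<integral>\<omega>. acoef * (gr n i \<omega>)\<^sup>2 + ecoef * (?\<Delta> \<omega>)\<^sup>2 \<partial>\<Omega>)"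
    proof (rule integral_mono_AE)
      show "AE \<omega> in \<Omega>. Y \<omega> * update (Suc n) i \<omega> * ?\<Delta> \<omega> \<le> acoef * (gr n i \<omega>)\<^sup>2 + ecoef * (?\<Delta> \<omega>)\<^sup>2"
        using AE_cdenom[of n i] AE_update_le[of "Suc n" i]
      proof eventually_elim
        case (elim \<omega>)
        let ?K = "umax / sqrt \<epsilon>"
        have s: "0 < sqrt \<epsilon>" using eps_pos by simp
        have K: "0 < ?K" using s umax_pos by simp
        have c: "0 < cdenom n i \<omega>" "inverse (cdenom n i \<omega>) \<le> inverse (sqrt \<epsilon>)"
          using elim s by (linarith, intro le_imp_inverse_le) auto
        have "Y \<omega> * update (Suc n) i \<omega> * ?\<Delta> \<omega>
          \<le> \<bar>gr n i \<omega>\<bar> * inverse (cdenom n i \<omega>) * \<bar>update (Suc n) i \<omega>\<bar> * \<bar>?\<Delta> \<omega>\<bar>"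
          using abs_ge_self[of "Y \<omega> * update (Suc n) i \<omega> * ?\<Delta> \<omega>"] c by (simp add: Y_def abs_mult)
        also have "\<dots> \<le> \<bar>gr n i \<omega>\<bar> * inverse (sqrt \<epsilon>) * umax * \<bar>?\<Delta> \<omega>\<bar>"
          using c elim s less_imp_le[OF c(1)] by (intro mult_mono) auto
        also have "\<dots> = \<bar>gr n i \<omega>\<bar> * (?K * \<bar>?\<Delta> \<omega>\<bar>)" by (simp add: field_simps)
        also have "\<dots> \<le> acoef * \<bar>gr n i \<omega>\<bar>\<^sup>2 + (?K * \<bar>?\<Delta> \<omega>\<bar>)\<^sup>2 / (4 * acoef)"
        proof -
          have "p * q \<le> acoef * p\<^sup>2 + q\<^sup>2 / (4 * acoef)" for p q :: real
          proof -
            have "0 \<le> (2 * acoef * p - q)\<^sup>2 / (4 * acoef)"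
              using acoef_pos by simp
            also have "\<dots> = acoef * p\<^sup>2 + q\<^sup>2 / (4 * acoef) - p * q"
              using acoef_pos by (simp add: field_simps power2_eq_square)
            finally show ?thesis by simp
          qed
          then show ?thesis .
        qed
        also have "\<dots> = acoef * (gr n i \<omega>)\<^sup>2 + ecoef * (?\<Delta> \<omega>)\<^sup>2"
          by (simp add: ecoef_def power_mult_distrib power_divide)
        finally show ?case .
      qed
    qed (intro bounded_rv_integrable bi)+
    also have "\<dots> = acoef * (\<integral>\<omega>. (gr n i \<omega>)\<^sup>2 \<partial>\<Omega>) + ecoef * (\<integral>\<omega>. (?\<Delta> \<omega>)\<^sup>2 \<partial>\<Omega>)"
      by (subst Bochner_Integration.integral_add) (auto intro!: bounded_rv_integrable bi)
    finally show ?thesis .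
  qed
  \<comment> \<open>Here \<open>cdenom\<close> is bounded above by \<open>smax\<close> and
    \<open>\<beta> (Suc n)\<close> by \<open>b\<close>; of the resulting \<open>2 * acoef\<close>,
    one \<open>acoef\<close> is left after the previous estimate.\<close>
  have 6: "2 * acoef * (\<integral>\<omega>. (gr n i \<omega>)\<^sup>2 \<partial>\<Omega>) \<le> (1 - \<beta> (Suc n)) * (\<integral>\<omega>. Y \<omega> * gr n i \<omega> \<partial>\<Omega>)"
  proof -
    have \<beta>: "1 - b \<le> 1 - \<beta> (Suc n)" using beta(2)[of "Suc n"] by simp
    have "(\<integral>\<omega>. (gr n i \<omega>)\<^sup>2 * inverse smax \<partial>\<Omega>) \<le> (\<integral>\<omega>. Y \<omega> * gr n i \<omega> \<partial>\<Omega>)"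
    proof (rule integral_mono_AE)
      show "AE \<omega> in \<Omega>. (gr n i \<omega>)\<^sup>2 * inverse smax \<le> Y \<omega> * gr n i \<omega>"
        using AE_cdenom[of n i]
      proof eventually_elim
        case (elim \<omega>)
        have "0 < sqrt \<epsilon>" using eps_pos by simp
        then have "inverse smax \<le> inverse (cdenom n i \<omega>)"
          using elim by (intro le_imp_inverse_le; linarith)
        then have "(gr n i \<omega>)\<^sup>2 * inverse smax \<le> (gr n i \<omega>)\<^sup>2 * inverse (cdenom n i \<omega>)"
          by (intro mult_left_mono) auto
        then show ?case by (simp add: Y_def power2_eq_square mult_ac)
      qed
    qed (intro bounded_rv_integrable bi)+
    then have "(\<integral>\<omega>. (gr n i \<omega>)\<^sup>2 \<partial>\<Omega>) * inverse smax \<le> (\<integral>\<omega>. Y \<omega> * gr n i \<omega> \<partial>\<Omega>)" by simp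
    then have "(1 - b) * ((\<integral>\<omega>. (gr n i \<omega>)\<^sup>2 \<partial>\<Omega>) * inverse smax) \<le> (1 - \<beta> (Suc n)) * (\<integral>\<omega>. Y \<omega> * gr n i \<omega> \<partial>\<Omega>)"
      using \<beta> beta(3) smax_pos by (intro mult_mono) (auto intro!: mult_nonneg_nonneg)
    moreover have "2 * acoef = (1 - b) * inverse smax"
      using smax_pos by (simp add: acoef_def field_simps)
    ultimately show ?thesis by (simp only: mult_ac)
  qed
  have "\<beta> (Suc n) * (\<integral>\<omega>. gr n i \<omega> * update n i \<omega> \<partial>\<Omega>) + (1 - \<beta> (Suc n)) * (\<integral>\<omega>. Y \<omega> * gr n i \<omega> \<partial>\<Omega>)
      = (\<integral>\<omega>. gr n i \<omega> * update (Suc n) i \<omega> \<partial>\<Omega>) + (\<integral>\<omega>. Y \<omega> * update (Suc n) i \<omega> * ?\<Delta> \<omega> \<partial>\<Omega>)"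
    using 3 unfolding 1 2 4 by (rule sym)
  with 5 6 show ?thesis by linarith
qed

section \<open>Variation of the conditional denominators\<close>

definition "dcoef = 2 * smax * (M\<^sup>2 / sqrt \<epsilon>)"

text \<open>Expand the square as \<open>?S'\<^sup>2 - ?S\<^sup>2 + 2 * ?S * (?S - ?S')\<close>. For
  a martingale the last term has mean zero; here it contributes at most
  \<open>dcoef * (1 - \<theta> (Suc n))\<close>, where \<open>dcoef\<close> collects the factor 2,
  the bound \<open>smax\<close> and the constant of \<open>denom_diff_le\<close>.\<close>

lemma integral_cdenom_diff_sq_le:
  "(\<integral>\<omega>. (cdenom (Suc n) i \<omega> - cdenom n i \<omega>)\<^sup>2 \<partial>\<Omega>)
    \<le> (\<integral>\<omega>. (cdenom (Suc n) i \<omega>)\<^sup>2 \<partial>\<Omega>) - (\<integral>\<omega>. (cdenom n i \<omega>)\<^sup>2 \<partial>\<Omega>) + dcoef * (1 - \<theta> (Suc n))"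
proof -
  let ?S = "cdenom n i" and ?S' = "cdenom (Suc n) i"
  \<comment> \<open>\<open>?S\<close> is known in both histories, so conditioning replaces each
    conditional denominator by the actual one, and these are close path by path.\<close>
  have 1: "(\<integral>\<omega>. ?S \<omega> * ?S' \<omega> \<partial>\<Omega>) = (\<integral>\<omega>. ?S \<omega> * denom (Suc n) i \<omega> \<partial>\<Omega>)"
    by (intro integral_mult_cdenom history_Suc cdenom_history bounded_rv_cdenom)
  have 2: "(\<integral>\<omega>. ?S \<omega> * ?S \<omega> \<partial>\<Omega>) = (\<integral>\<omega>. ?S \<omega> * denom n i \<omega> \<partial>\<Omega>)"
    by (intro integral_mult_cdenom cdenom_history bounded_rv_cdenom)
  have "(\<integral>\<omega>. ?S \<omega> * (denom n i \<omega> - denom (Suc n) i \<omega>) \<partial>\<Omega>) \<le> (\<integral>\<omega>. smax * (M\<^sup>2 / sqrt \<epsilon> * (1 - \<theta> (Suc n))) \<partial>\<Omega>)"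
  proof (rule integral_mono_AE)
    show "AE \<omega> in \<Omega>. ?S \<omega> * (denom n i \<omega> - denom (Suc n) i \<omega>) \<le> smax * (M\<^sup>2 / sqrt \<epsilon> * (1 - \<theta> (Suc n)))"
      using AE_cdenom[of n i] AE_good AE_space
    proof eventually_elim
      case (elim \<omega>)
      have S: "\<bar>?S \<omega>\<bar> \<le> smax" using elim eps_pos real_sqrt_gt_zero[of \<epsilon>] by linarith
      have "?S \<omega> * (denom n i \<omega> - denom (Suc n) i \<omega>) \<le> \<bar>?S \<omega>\<bar> * \<bar>denom n i \<omega> - denom (Suc n) i \<omega>\<bar>"
        using abs_ge_self by (metis abs_mult)
      also have "\<dots> \<le> smax * (M\<^sup>2 / sqrt \<epsilon> * (1 - \<theta> (Suc n)))"
        using S denom_diff_le[of \<omega> n i] elim by (intro mult_mono) (auto simp: abs_minus_commute)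
      finally show ?case .
    qed
  qed (intro bounded_rv_integrable bounded_rv_adam)+
  then have 3: "(\<integral>\<omega>. ?S \<omega> * denom n i \<omega> \<partial>\<Omega>) - (\<integral>\<omega>. ?S \<omega> * denom (Suc n) i \<omega> \<partial>\<Omega>)
      \<le> smax * (M\<^sup>2 / sqrt \<epsilon> * (1 - \<theta> (Suc n)))"
    by (subst Bochner_Integration.integral_diff[symmetric])
       (auto simp: right_diff_distrib prob_space intro!: bounded_rv_integrable bounded_rv_adam)
  have "(\<integral>\<omega>. (?S' \<omega> - ?S \<omega>)\<^sup>2 \<partial>\<Omega>)
      = (\<integral>\<omega>. (?S' \<omega>)\<^sup>2 - (?S \<omega>)\<^sup>2 + 2 * (?S \<omega> * ?S \<omega> - ?S \<omega> * ?S' \<omega>) \<partial>\<Omega>)"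
    by (intro Bochner_Integration.integral_cong refl) (simp add: power2_eq_square algebra_simps)
  also have "\<dots> = (\<integral>\<omega>. (?S' \<omega>)\<^sup>2 - (?S \<omega>)\<^sup>2 \<partial>\<Omega>) + (\<integral>\<omega>. 2 * (?S \<omega> * ?S \<omega> - ?S \<omega> * ?S' \<omega>) \<partial>\<Omega>)"
    by (intro Bochner_Integration.integral_add bounded_rv_integrable bounded_rv_adam)
  also have "(\<integral>\<omega>. (?S' \<omega>)\<^sup>2 - (?S \<omega>)\<^sup>2 \<partial>\<Omega>) = (\<integral>\<omega>. (?S' \<omega>)\<^sup>2 \<partial>\<Omega>) - (\<integral>\<omega>. (?S \<omega>)\<^sup>2 \<partial>\<Omega>)"
    by (intro Bochner_Integration.integral_diff bounded_rv_integrable bounded_rv_adam)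
  also have "(\<integral>\<omega>. 2 * (?S \<omega> * ?S \<omega> - ?S \<omega> * ?S' \<omega>) \<partial>\<Omega>)
      = 2 * ((\<integral>\<omega>. ?S \<omega> * ?S \<omega> \<partial>\<Omega>) - (\<integral>\<omega>. ?S \<omega> * ?S' \<omega> \<partial>\<Omega>))"
    by (subst Bochner_Integration.integral_diff[symmetric])
       (simp_all add: bounded_rv_integrable bounded_rv_adam del: right_diff_distrib_numeral)
  finally have "(\<integral>\<omega>. (?S' \<omega> - ?S \<omega>)\<^sup>2 \<partial>\<Omega>) = (\<integral>\<omega>. (?S' \<omega>)\<^sup>2 \<partial>\<Omega>) - (\<integral>\<omega>. (?S \<omega>)\<^sup>2 \<partial>\<Omega>)
      + 2 * ((\<integral>\<omega>. ?S \<omega> * denom n i \<omega> \<partial>\<Omega>) - (\<integral>\<omega>. ?S \<omega> * denom (Suc n) i \<omega> \<partial>\<Omega>))"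
    unfolding 1 2 .
  moreover have "dcoef * (1 - \<theta> (Suc n)) = 2 * (smax * (M\<^sup>2 / sqrt \<epsilon> * (1 - \<theta> (Suc n))))"
    by (simp add: dcoef_def)
  moreover have "p \<le> q - r + w"
    if "p = q - r + 2 * (s - u)" "w = 2 * z" "s - u \<le> z" for p q r s u w z :: real
    using that by (simp add: algebra_simps)
  ultimately show ?thesis using 3 by blast
qed

section \<open>Descent of the expected objective\<close>

lemma bounded_rv_f: "bounded_rv (\<lambda>\<omega>. f (x (Suc n) \<omega>))"
proof -
  define r where "r = (\<Sum>k<n. \<eta> (Suc k) * (CARD('d) * umax))"
  \<comment> \<open>A continuous function is bounded on the ball that contains the iterate. The
    bound depends on \<open>n\<close> and serves only integrability.\<close>
  have "compact (f ` cball x1 r)"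
    by (intro compact_continuous_image continuous_on_subset[OF continuous_f]) auto
  then obtain c where c: "\<And>y. y \<in> cball x1 r \<Longrightarrow> \<bar>f y\<bar> \<le> c"
    using compact_imp_bounded by (force simp: bounded_iff)
  have "AE \<omega> in \<Omega>. \<bar>f (x (Suc n) \<omega>)\<bar> \<le> c"
    using AE_good AE_space
    by eventually_elim (use dist_start_le in \<open>auto intro!: c simp: r_def dist_norm norm_minus_commute\<close>)
  then show ?thesis by (intro bounded_rvI) auto
qed

lemma expected_descent:
  "(\<integral>\<omega>. f (x (Suc (Suc n)) \<omega>) \<partial>\<Omega>) \<le> (\<integral>\<omega>. f (x (Suc n) \<omega>) \<partial>\<Omega>)
    - \<eta> (Suc n) * (\<Sum>i\<in>UNIV. \<integral>\<omega>. gr n i \<omega> * update (Suc n) i \<omega> \<partial>\<Omega>)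
    + L * (CARD('d) * umax)\<^sup>2 * (\<eta> (Suc n))\<^sup>2"
proof -
  let ?I = "\<lambda>\<omega>. \<Sum>i\<in>UNIV. gr n i \<omega> * update (Suc n) i \<omega>"
  let ?c = "L * (CARD('d) * umax)\<^sup>2 * (\<eta> (Suc n))\<^sup>2"
  have "(\<integral>\<omega>. f (x (Suc (Suc n)) \<omega>) \<partial>\<Omega>) \<le> (\<integral>\<omega>. f (x (Suc n) \<omega>) - \<eta> (Suc n) * ?I \<omega> + ?c \<partial>\<Omega>)"
  proof (rule integral_mono_AE)
    show "AE \<omega> in \<Omega>. f (x (Suc (Suc n)) \<omega>) \<le> f (x (Suc n) \<omega>) - \<eta> (Suc n) * ?I \<omega> + ?c"
      using AE_good AE_space
    proof eventually_elim
      case (elim \<omega>)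
      let ?y = "x (Suc n) \<omega>" and ?z = "x (Suc (Suc n)) \<omega>"
      have "f ?z \<le> f ?y + inner (grad_f ?y) (?z - ?y) + L * (norm (?z - ?y))\<^sup>2"
        by (rule smooth_upper_bound[OF grad smooth])
      moreover have "inner (grad_f ?y) (?z - ?y) = - \<eta> (Suc n) * ?I \<omega>"
        using elim by (simp add: x_Suc inner_vec_def gr_def sum_distrib_left sum_negf mult_ac)
      moreover have "L * (norm (?z - ?y))\<^sup>2 \<le> L * (\<eta> (Suc n) * (CARD('d) * umax))\<^sup>2"
        using elim L_pos by (intro mult_left_mono power_mono step_le) auto
      ultimately show ?case by (simp add: power_mult_distrib mult_ac)
    qed
  qed (intro bounded_rv_integrable bounded_rv_adam bounded_rv_f)+
  also have "\<dots> = (\<integral>\<omega>. f (x (Suc n) \<omega>) - \<eta> (Suc n) * ?I \<omega> \<partial>\<Omega>) + (\<integral>\<omega>. ?c \<partial>\<Omega>)"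
    by (intro Bochner_Integration.integral_add bounded_rv_integrable bounded_rv_adam bounded_rv_f)
  also have "(\<integral>\<omega>. f (x (Suc n) \<omega>) - \<eta> (Suc n) * ?I \<omega> \<partial>\<Omega>)
    = (\<integral>\<omega>. f (x (Suc n) \<omega>) \<partial>\<Omega>) - (\<integral>\<omega>. \<eta> (Suc n) * ?I \<omega> \<partial>\<Omega>)"
    by (intro Bochner_Integration.integral_diff bounded_rv_integrable bounded_rv_adam bounded_rv_f)
  also have "(\<integral>\<omega>. \<eta> (Suc n) * ?I \<omega> \<partial>\<Omega>) = \<eta> (Suc n) * (\<Sum>i\<in>UNIV. \<integral>\<omega>. gr n i \<omega> * update (Suc n) i \<omega> \<partial>\<Omega>)"
    by (subst Bochner_Integration.integral_sum[symmetric])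
       (auto intro!: bounded_rv_integrable bounded_rv_adam)
  also have "(\<integral>\<omega>. ?c \<partial>\<Omega>) = ?c" by (simp add: prob_space)
  finally show ?thesis .
qed

text \<open>The next momentum step pairs the same update with the next gradient. By smoothness and
  the step bound, exchanging the gradients costs a term of order
  \<open>\<eta> (Suc n)\<close>.\<close>

lemma gr_drift:
  "(\<integral>\<omega>. gr n i \<omega> * update (Suc n) i \<omega> \<partial>\<Omega>) - L * (CARD('d) * umax) * umax * \<eta> (Suc n)
    \<le> (\<integral>\<omega>. gr (Suc n) i \<omega> * update (Suc n) i \<omega> \<partial>\<Omega>)"
proof -
  let ?c = "L * (CARD('d) * umax) * umax * \<eta> (Suc n)"
  have "(\<integral>\<omega>. gr n i \<omega> * update (Suc n) i \<omega> - ?c \<partial>\<Omega>) \<le> (\<integral>\<omega>. gr (Suc n) i \<omega> * update (Suc n) i \<omega> \<partial>\<Omega>)"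
  proof (rule integral_mono_AE)
    show "AE \<omega> in \<Omega>. gr n i \<omega> * update (Suc n) i \<omega> - ?c \<le> gr (Suc n) i \<omega> * update (Suc n) i \<omega>"
      using AE_good AE_space AE_update_le[of "Suc n" i]
    proof eventually_elim
      case (elim \<omega>)
      let ?y = "x (Suc n) \<omega>" and ?z = "x (Suc (Suc n)) \<omega>"
      have "\<bar>gr (Suc n) i \<omega> - gr n i \<omega>\<bar> \<le> norm (grad_f ?z - grad_f ?y)"
        unfolding gr_def using component_le_norm_cart[of "grad_f ?z - grad_f ?y" i] by simp
      also have "\<dots> \<le> L * norm (?z - ?y)" by (rule smooth)
      also have "\<dots> \<le> L * (\<eta> (Suc n) * (CARD('d) * umax))"
        using L_pos elim by (intro mult_left_mono step_le) auto
      finally have "\<bar>gr (Suc n) i \<omega> - gr n i \<omega>\<bar> \<le> L * (\<eta> (Suc n) * (CARD('d) * umax))" .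
      then have "\<bar>gr (Suc n) i \<omega> - gr n i \<omega>\<bar> * \<bar>update (Suc n) i \<omega>\<bar> \<le> L * (\<eta> (Suc n) * (CARD('d) * umax)) * umax"
        using elim by (intro mult_mono) auto
      then have "\<bar>(gr (Suc n) i \<omega> - gr n i \<omega>) * update (Suc n) i \<omega>\<bar> \<le> ?c"
        by (simp add: abs_mult mult_ac)
      then show ?case unfolding left_diff_distrib by linarith
    qed
  qed (intro bounded_rv_integrable bounded_rv_adam)+
  also have "(\<integral>\<omega>. gr n i \<omega> * update (Suc n) i \<omega> - ?c \<partial>\<Omega>) = (\<integral>\<omega>. gr n i \<omega> * update (Suc n) i \<omega> \<partial>\<Omega>) - (\<integral>\<omega>. ?c \<partial>\<Omega>)"
    by (intro Bochner_Integration.integral_diff bounded_rv_integrable bounded_rv_adam)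
  finally show ?thesis by (simp add: prob_space)
qed

text \<open>The coordinate estimates are summed over all coordinates and fed into the descent
  recursion; this is the source of the factors \<open>CARD('d)\<close>. Index \<open>n\<close> of
  the recursion stands for step \<open>Suc n\<close> of the algorithm.\<close>

lemma summable_weighted_grad:
  assumes low: "bdd_below (range f)"
    and sq: "summable (\<lambda>k. (\<eta> (Suc k))\<^sup>2)"
    and th: "summable (\<lambda>k. \<eta> (Suc k) * (1 - \<theta> (Suc k)))"
    and dec: "\<And>j k. 1 \<le> j \<Longrightarrow> j \<le> k \<Longrightarrow> \<alpha> k \<le> \<alpha> j" and C: "0 < C0" "0 < C1"
    and cmp: "\<And>k. k \<ge> 1 \<Longrightarrow> C0 * \<alpha> k \<le> \<eta> k" "\<And>k. k \<ge> 1 \<Longrightarrow> \<eta> k \<le> C1 * \<alpha> k"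
  shows "summable (\<lambda>n. \<eta> (Suc n) * (\<Sum>i\<in>UNIV. \<integral>\<omega>. (gr n i \<omega>)\<^sup>2 \<partial>\<Omega>))"
proof (rule summable_if_descent_with_memory[where \<alpha> = "\<lambda>n. \<alpha> (Suc n)" and \<beta> = "\<lambda>n. \<beta> (Suc n)"
      and \<delta> = "\<lambda>n. 1 - \<theta> (Suc n)" and a = acoef and ?C0.0 = C0 and ?C1.0 = C1 and b = b
      and ?c1.0 = "L * (CARD('d) * umax)\<^sup>2" and ?c2.0 = ecoef
      and ?c3.0 = "real CARD('d) * (L * (CARD('d) * umax) * umax)" and ?c4.0 = "real CARD('d) * dcoef"
      and e = "\<lambda>n. \<Sum>i\<in>UNIV. \<integral>\<omega>. (cdenom (Suc n) i \<omega> - cdenom n i \<omega>)\<^sup>2 \<partial>\<Omega>"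
      and T = "\<lambda>n. \<Sum>i\<in>UNIV. \<integral>\<omega>. (cdenom n i \<omega>)\<^sup>2 \<partial>\<Omega>" and K = "real CARD('d) * smax\<^sup>2"
      and F = "\<lambda>n. \<integral>\<omega>. f (x (Suc n) \<omega>) \<partial>\<Omega>" and Fmin = "Inf (range f)"
      and R = "\<lambda>n. \<Sum>i\<in>UNIV. \<integral>\<omega>. gr n i \<omega> * update n i \<omega> \<partial>\<Omega>"
      and P = "\<lambda>n. \<Sum>i\<in>UNIV. \<integral>\<omega>. gr n i \<omega> * update (Suc n) i \<omega> \<partial>\<Omega>"])
  fix n
  show "(\<Sum>i\<in>UNIV. \<integral>\<omega>. (cdenom n i \<omega>)\<^sup>2 \<partial>\<Omega>) \<le> real CARD('d) * smax\<^sup>2"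
  proof -
    have "(\<integral>\<omega>. (cdenom n i \<omega>)\<^sup>2 \<partial>\<Omega>) \<le> (\<integral>\<omega>. smax\<^sup>2 \<partial>\<Omega>)" for i
    proof (rule integral_mono_AE)
      show "AE \<omega> in \<Omega>. (cdenom n i \<omega>)\<^sup>2 \<le> smax\<^sup>2"
        using AE_cdenom[of n i]
      proof eventually_elim
        case (elim \<omega>)
        have "0 < sqrt \<epsilon>" using eps_pos by simp
        with elim show ?case by (intro power_mono; linarith)
      qed
    qed (intro bounded_rv_integrable bounded_rv_adam)+
    then have "(\<Sum>i\<in>UNIV. \<integral>\<omega>. (cdenom n i \<omega>)\<^sup>2 \<partial>\<Omega>) \<le> (\<Sum>i\<in>(UNIV::'d set). smax\<^sup>2)"
      by (intro sum_mono) (simp add: prob_space)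
    then show ?thesis by simp
  qed
  show "Inf (range f) \<le> (\<integral>\<omega>. f (x (Suc n) \<omega>) \<partial>\<Omega>)"
  proof -
    have "(\<integral>\<omega>. Inf (range f) \<partial>\<Omega>) \<le> (\<integral>\<omega>. f (x (Suc n) \<omega>) \<partial>\<Omega>)"
      by (intro integral_mono bounded_rv_integrable bounded_rv_const bounded_rv_f cInf_lower low) auto
    then show ?thesis by (simp add: prob_space)
  qed
  show "\<beta> (Suc n) * (\<Sum>i\<in>UNIV. \<integral>\<omega>. gr n i \<omega> * update n i \<omega> \<partial>\<Omega>)
      + acoef * (\<Sum>i\<in>UNIV. \<integral>\<omega>. (gr n i \<omega>)\<^sup>2 \<partial>\<Omega>)
      - ecoef * (\<Sum>i\<in>UNIV. \<integral>\<omega>. (cdenom (Suc n) i \<omega> - cdenom n i \<omega>)\<^sup>2 \<partial>\<Omega>)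
      \<le> (\<Sum>i\<in>UNIV. \<integral>\<omega>. gr n i \<omega> * update (Suc n) i \<omega> \<partial>\<Omega>)"
    using sum_mono[where K = "UNIV :: 'd set", OF component_energy[of n]]
    by (simp only: sum.distrib sum_subtractf sum_distrib_left)
  show "(\<Sum>i\<in>UNIV. \<integral>\<omega>. gr n i \<omega> * update (Suc n) i \<omega> \<partial>\<Omega>)
      - real CARD('d) * (L * (CARD('d) * umax) * umax) * \<eta> (Suc n)
      \<le> (\<Sum>i\<in>UNIV. \<integral>\<omega>. gr (Suc n) i \<omega> * update (Suc n) i \<omega> \<partial>\<Omega>)"
    using sum_mono[where K = "UNIV :: 'd set", OF gr_drift[of n]] by (simp add: sum_subtractf mult.assoc)
  show "(\<Sum>i\<in>UNIV. \<integral>\<omega>. (cdenom (Suc n) i \<omega> - cdenom n i \<omega>)\<^sup>2 \<partial>\<Omega>)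
      \<le> (\<Sum>i\<in>UNIV. \<integral>\<omega>. (cdenom (Suc n) i \<omega>)\<^sup>2 \<partial>\<Omega>) - (\<Sum>i\<in>UNIV. \<integral>\<omega>. (cdenom n i \<omega>)\<^sup>2 \<partial>\<Omega>)
        + real CARD('d) * dcoef * (1 - \<theta> (Suc n))"
    using sum_mono[where K = "UNIV :: 'd set", OF integral_cdenom_diff_sq_le[of n]]
    by (simp add: sum.distrib sum_subtractf mult.assoc)
  show "0 \<le> \<beta> (Suc n)" "\<beta> (Suc n) \<le> b" "0 < \<eta> (Suc n)" "0 \<le> 1 - \<theta> (Suc n)"
    "C0 * \<alpha> (Suc n) \<le> \<eta> (Suc n)" "\<eta> (Suc n) \<le> C1 * \<alpha> (Suc n)"
    using beta(1,2)[of "Suc n"] eta_pos[of "Suc n"] theta(2)[of "Suc n"] cmp[of "Suc n"] by simp_all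
  show "(\<integral>\<omega>. f (x (Suc (Suc n)) \<omega>) \<partial>\<Omega>) \<le> (\<integral>\<omega>. f (x (Suc n) \<omega>) \<partial>\<Omega>)
    - \<eta> (Suc n) * (\<Sum>i\<in>UNIV. \<integral>\<omega>. gr n i \<omega> * update (Suc n) i \<omega> \<partial>\<Omega>)
    + L * (CARD('d) * umax)\<^sup>2 * (\<eta> (Suc n))\<^sup>2"
    by (rule expected_descent)
  show "0 \<le> (\<Sum>i\<in>UNIV. \<integral>\<omega>. (gr n i \<omega>)\<^sup>2 \<partial>\<Omega>)"
    "0 \<le> (\<Sum>i\<in>UNIV. \<integral>\<omega>. (cdenom (Suc n) i \<omega> - cdenom n i \<omega>)\<^sup>2 \<partial>\<Omega>)"
    "0 \<le> (\<Sum>i\<in>UNIV. \<integral>\<omega>. (cdenom n i \<omega>)\<^sup>2 \<partial>\<Omega>)"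
    by (intro sum_nonneg integral_nonneg; simp)+
next
  show "decseq (\<lambda>n. \<alpha> (Suc n))" by (auto intro!: decseq_SucI dec)
  show "0 \<le> real CARD('d) * dcoef"
    unfolding dcoef_def using smax_pos eps_pos by (auto intro!: mult_nonneg_nonneg)
  show "0 \<le> ecoef" unfolding ecoef_def using acoef_pos by auto
  show "0 \<le> L * (CARD('d) * umax)\<^sup>2" "0 \<le> real CARD('d) * (L * (CARD('d) * umax) * umax)"
    using L_pos umax_pos by auto
  \<comment> \<open>The recursion starts without memory because the initial momentum is
    zero.\<close>
  show "(\<Sum>i\<in>UNIV. \<integral>\<omega>. gr 0 i \<omega> * update 0 i \<omega> \<partial>\<Omega>) = 0"
  proof (intro sum.neutral ballI)
    fix i
    have "(\<integral>\<omega>. gr 0 i \<omega> * update 0 i \<omega> \<partial>\<Omega>) = (\<integral>\<omega>. 0 \<partial>\<Omega>)"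
      by (intro Bochner_Integration.integral_cong refl) (simp add: update_def m_0)
    then show "(\<integral>\<omega>. gr 0 i \<omega> * update 0 i \<omega> \<partial>\<Omega>) = 0" by simp
  qed
  show "0 < C0" "0 < C1" "summable (\<lambda>n. (\<eta> (Suc n))\<^sup>2)" "summable (\<lambda>n. \<eta> (Suc n) * (1 - \<theta> (Suc n)))"
    "b < 1" "0 < acoef"
    by (fact C sq th beta(3) acoef_pos)+
qed

section \<open>Convergence of the gradient norms\<close>

lemma grad_tendsto_zero:
  assumes low: "bdd_below (range f)"
    and div: "filterlim (\<lambda>n. \<Sum>k=1..n. \<eta> k) at_top sequentially"
    and sq: "summable (\<lambda>k. (\<eta> (Suc k))\<^sup>2)"
    and th: "summable (\<lambda>k. \<eta> (Suc k) * (1 - \<theta> (Suc k)))"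
    and dec: "\<And>j k. 1 \<le> j \<Longrightarrow> j \<le> k \<Longrightarrow> \<alpha> k \<le> \<alpha> j" and C: "0 < C0" "0 < C1"
    and cmp: "\<And>k. k \<ge> 1 \<Longrightarrow> C0 * \<alpha> k \<le> \<eta> k" "\<And>k. k \<ge> 1 \<Longrightarrow> \<eta> k \<le> C1 * \<alpha> k"
  shows "AE \<omega> in \<Omega>. (\<lambda>n. norm (grad_f (x (Suc n) \<omega>))) \<longlonglongrightarrow> 0"
proof -
  let ?a = "\<lambda>n \<omega>. norm (grad_f (x (Suc n) \<omega>))"
  have norm_sq: "(?a n \<omega>)\<^sup>2 = (\<Sum>i\<in>UNIV. (gr n i \<omega>)\<^sup>2)" for n \<omega>
    by (simp add: norm_vec_def L2_set_def gr_def sum_nonneg)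
  have not_summable: "\<not> summable (\<lambda>n. \<eta> (Suc n))"
  proof
    assume "summable (\<lambda>n. \<eta> (Suc n))"
    then have "(\<lambda>n. \<Sum>k<n. \<eta> (Suc k)) \<longlonglongrightarrow> (\<Sum>n. \<eta> (Suc n))" by (rule summable_LIMSEQ)
    moreover have "(\<Sum>k<n. \<eta> (Suc k)) = (\<Sum>k=1..n. \<eta> k)" for n
      by (induction n) auto
    ultimately have "(\<lambda>n. \<Sum>k=1..n. \<eta> k) \<longlonglongrightarrow> (\<Sum>n. \<eta> (Suc n))" by simp
    then show False
      using not_tendsto_and_filterlim_at_infinity filterlim_at_top_imp_at_infinity[OF div]
        trivial_limit_sequentially by blast
  qed
  \<comment> \<open>Summability in expectation gives pathwise summability, the weighted input of the
    cube argument.\<close>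
  have "AE \<omega> in \<Omega>. summable (\<lambda>n. \<eta> (Suc n) * (?a n \<omega>)\<^sup>2)"
  proof (rule AE_summable_if_summable_integral)
    show "integrable \<Omega> (\<lambda>\<omega>. \<eta> (Suc n) * (?a n \<omega>)\<^sup>2)" for n
      unfolding norm_sq by (intro bounded_rv_integrable bounded_rv_adam)
    show "0 \<le> \<eta> (Suc n) * (?a n \<omega>)\<^sup>2" for n \<omega> using eta_pos[of "Suc n"] by simp
    have "(\<integral>\<omega>. \<eta> (Suc n) * (?a n \<omega>)\<^sup>2 \<partial>\<Omega>) = \<eta> (Suc n) * (\<Sum>i\<in>UNIV. \<integral>\<omega>. (gr n i \<omega>)\<^sup>2 \<partial>\<Omega>)" for n
      unfolding norm_sq
      by (subst Bochner_Integration.integral_sum[symmetric])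
         (auto intro!: bounded_rv_integrable bounded_rv_adam)
    then show "summable (\<lambda>n. \<integral>\<omega>. \<eta> (Suc n) * (?a n \<omega>)\<^sup>2 \<partial>\<Omega>)"
      using summable_weighted_grad[OF low sq th dec C cmp] by (simp only:)
  qed
  then show ?thesis using AE_good AE_space
  proof eventually_elim
    case (elim \<omega>)
    show ?case
    proof (rule tendsto_zero_if_weighted_squares_summable)
      show "\<bar>?a (Suc n) \<omega> - ?a n \<omega>\<bar> \<le> L * (CARD('d) * umax) * \<eta> (Suc n)" for n
      proof -
        have "\<bar>?a (Suc n) \<omega> - ?a n \<omega>\<bar> \<le> norm (grad_f (x (Suc (Suc n)) \<omega>) - grad_f (x (Suc n) \<omega>))"
          by (rule norm_triangle_ineq3)
        also have "\<dots> \<le> L * norm (x (Suc (Suc n)) \<omega> - x (Suc n) \<omega>)" by (rule smooth)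
        also have "\<dots> \<le> L * (\<eta> (Suc n) * (CARD('d) * umax))"
          using L_pos elim by (intro mult_left_mono step_le) auto
        finally show ?thesis by (simp add: mult_ac)
      qed
      show "0 < \<eta> (Suc n)" for n using eta_pos by simp
      show "summable (\<lambda>n. \<eta> (Suc n) * (?a n \<omega>)\<^sup>2)" using elim by simp
    qed (simp_all add: sq not_summable)
  qed
qed

lemma integrable_norm_grad: "integrable \<Omega> (\<lambda>\<omega>. norm (grad_f (x (Suc n) \<omega>)))"
proof (rule integrable_const_bound)
  show "(\<lambda>\<omega>. norm (grad_f (x (Suc n) \<omega>))) \<in> borel_measurable \<Omega>"
    using borel_measurable_continuous_onI[OF continuous_grad] by measurable
qed (use AE_norm_grad_le in auto)

text \<open>Dominated convergence with the constant \<open>CARD('d) * M\<close>.\<close>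

lemma expectation_norm_grad_tendsto_zero:
  assumes "AE \<omega> in \<Omega>. (\<lambda>n. norm (grad_f (x (Suc n) \<omega>))) \<longlonglongrightarrow> 0"
  shows "(\<lambda>n. \<integral>\<omega>. norm (grad_f (x (Suc n) \<omega>)) \<partial>\<Omega>) \<longlonglongrightarrow> 0"
proof -
  have "(\<lambda>n. \<integral>\<omega>. norm (grad_f (x (Suc n) \<omega>)) \<partial>\<Omega>) \<longlonglongrightarrow> (\<integral>\<omega>. 0 \<partial>\<Omega>)"
  proof (rule integral_dominated_convergence)
    show "integrable \<Omega> (\<lambda>\<omega>. CARD('d) * M)" by simp
  qed (use assms AE_norm_grad_le integrable_norm_grad in auto)
  then show ?thesis by simp
qed

end

theorem theorem11:
  fixes \<Omega> :: "'w measure"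
    and D :: "'s measure"
    and l :: "real ^ 'd \<Rightarrow> 's \<Rightarrow> real"
    and f :: "real ^ 'd \<Rightarrow> real"
    and grad_f :: "real ^ 'd \<Rightarrow> real ^ 'd"
    and \<xi> :: "nat \<Rightarrow> 'w \<Rightarrow> 's"
    and g m v x :: "nat \<Rightarrow> 'w \<Rightarrow> real ^ 'd"
    and x1 :: "real ^ 'd"
    and \<eta> \<beta> \<theta> :: "nat \<Rightarrow> real"
    and \<epsilon> b :: real
  assumes "prob_space \<Omega>" and "prob_space D"
    and f_def: "\<And>y. integrable D (l y)" "\<And>y. f y = (\<integral>s. l y s \<partial>D)"
    and f_diff: "\<And>y. GDERIV f y :> grad_f y"
    and params: "\<And>k. k \<ge> 1 \<Longrightarrow> \<eta> k > 0" "\<epsilon> > 0"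
      "\<And>k. k \<ge> 1 \<Longrightarrow> 0 \<le> \<beta> k" "\<And>k. k \<ge> 1 \<Longrightarrow> \<beta> k \<le> b" "b < 1"
      "\<And>k. k \<ge> 1 \<Longrightarrow> 0 < \<theta> k" "\<And>k. k \<ge> 1 \<Longrightarrow> \<theta> k < 1"
    and samples: "\<And>k. k \<ge> 1 \<Longrightarrow> \<xi> k \<in> \<Omega> \<rightarrow>\<^sub>M D"
    and stoch_grad: "\<And>k. k \<ge> 1 \<Longrightarrow> g k \<in> borel_measurable \<Omega>"
      "\<And>k \<omega>. k \<ge> 1 \<Longrightarrow> \<omega> \<in> space \<Omega> \<Longrightarrow> GDERIV (\<lambda>y. l y (\<xi> k \<omega>)) (x k \<omega>) :> g k \<omega>"
    and adam: "\<And>\<omega>. \<omega> \<in> space \<Omega> \<Longrightarrow>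
      adam_trajectory \<eta> \<epsilon> \<beta> \<theta> x1 (\<lambda>k. g k \<omega>) (\<lambda>k. m k \<omega>) (\<lambda>k. v k \<omega>) (\<lambda>k. x k \<omega>)"
    and unbiased: "\<And>k. k \<ge> 1 \<Longrightarrow>
      AE \<omega> in \<Omega>. vec_cond_exp \<Omega> (history_algebra \<Omega> x k) (g k) \<omega> = grad_f (x k \<omega>)"
    and bounded_grad: "\<exists>M>0. \<forall>k\<ge>1. AE \<omega> in \<Omega>. norm (g k \<omega>) \<le> M"
    and f_bounded_below: "bdd_below (range f)"
    and f_smooth: "\<exists>L>0. \<forall>y z. norm (grad_f y - grad_f z) \<le> L * norm (y - z)"
    and step_sum: "filterlim (\<lambda>n. \<Sum>k=1..n. \<eta> k) at_top sequentially"
    and step_square_sum: "summable (\<lambda>k. (\<eta> (Suc k))\<^sup>2)"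
    and step_theta_sum: "summable (\<lambda>k. \<eta> (Suc k) * (1 - \<theta> (Suc k)))"
    and step_comparable: "\<exists>\<alpha> C0 C1. (\<forall>j k. 1 \<le> j \<and> j \<le> k \<longrightarrow> \<alpha> k \<le> \<alpha> j) \<and> C0 > 0 \<and> C1 > 0 \<and>
      (\<forall>k\<ge>1. C0 * \<alpha> k \<le> \<eta> k \<and> \<eta> k \<le> C1 * \<alpha> k)"
  shows "(AE \<omega> in \<Omega>. (\<lambda>k. norm (grad_f (x k \<omega>))) \<longlonglongrightarrow> 0) \<and>
    (\<forall>k\<ge>1. integrable \<Omega> (\<lambda>\<omega>. norm (grad_f (x k \<omega>)))) \<and>
    (\<lambda>k. \<integral>\<omega>. norm (grad_f (x k \<omega>)) \<partial>\<Omega>) \<longlonglongrightarrow> 0"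
proof -
  obtain M where M: "0 < M" "\<And>k. k \<ge> 1 \<Longrightarrow> AE \<omega> in \<Omega>. norm (g k \<omega>) \<le> M"
    using bounded_grad by blast
  obtain L where L: "0 < L" "\<And>y z. norm (grad_f y - grad_f z) \<le> L * norm (y - z)"
    using f_smooth by blast
  obtain \<alpha> C0 C1 where \<alpha>: "\<And>j k. 1 \<le> j \<Longrightarrow> j \<le> k \<Longrightarrow> \<alpha> k \<le> \<alpha> j" "0 < C0" "0 < C1"
    "\<And>k. k \<ge> 1 \<Longrightarrow> C0 * \<alpha> k \<le> \<eta> k" "\<And>k. k \<ge> 1 \<Longrightarrow> \<eta> k \<le> C1 * \<alpha> k"
    using step_comparable by blast
  interpret prob_space \<Omega> by fact
  interpret adam \<Omega> f grad_f g m v x x1 \<eta> \<beta> \<theta> \<epsilon> b M L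
    by unfold_locales (fact f_diff params stoch_grad(1) adam unbiased M L)+
  have lim: "AE \<omega> in \<Omega>. (\<lambda>n. norm (grad_f (x (Suc n) \<omega>))) \<longlonglongrightarrow> 0"
    by (rule grad_tendsto_zero[OF f_bounded_below step_sum step_square_sum step_theta_sum \<alpha>])
  \<comment> \<open>Integrability is part of the claim because the integral of a non-integrable
    function is 0 by default, which would make the limit in mean meaningless.\<close>
  have "integrable \<Omega> (\<lambda>\<omega>. norm (grad_f (x k \<omega>)))" if "k \<ge> 1" for k
    using integrable_norm_grad[of "k - 1"] that by simp
  \<comment> \<open>The analysis is indexed from the first iterate; the shift back adds only the
    term at index 0, which does not affect the limit.\<close>
  moreover have "(\<lambda>k. \<integral>\<omega>. norm (grad_f (x k \<omega>)) \<partial>\<Omega>) \<longlonglongrightarrow> 0"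
    using expectation_norm_grad_tendsto_zero[OF lim] by (rule LIMSEQ_imp_Suc)
  moreover have "AE \<omega> in \<Omega>. (\<lambda>k. norm (grad_f (x k \<omega>))) \<longlonglongrightarrow> 0"
    using lim by eventually_elim (rule LIMSEQ_imp_Suc)
  ultimately show ?thesis by blast
qed

end
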